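(* For all $\beta>0$, $\lambda\in\mathbb R$, $h\in\mathbb R$, the limit $\lim_{N\to\infty}A_N(\beta,\lambda,h)$ exists and $$\lim_{N\to\infty}A_N(\beta,\lambda,h)=\sup_{N\ge1}A_N(\beta,\lambda,h).$$
   Context: For $N\ge 1$, $\beta>0$, $\lambda\in\mathbb{R}$, $h\in\mathbb{R}$, let $J=(J_{ij})_{i,j=1}^N$ be $N^2$ i.i.d. standard Gaussian $\mathcal N(0,1)$ random variables (one for each ordered pair $(i,j)$, diagonal pairs included). $\mathbb E_z$ denotes integration with respect to the standard Gaussian measure $(2\pi)^{-N/2}e^{-\|z\|^2/2}dz$ on $\mathbb R^N$, and $\mathbb E$ denotes expectation with respect to the disorder. The partition function is $$Z_N(\beta,\lambda,h;J)=\mathbb E_z\exp\Big(\frac{\beta}{\sqrt{2N}}\sum_{i,j=1}^N J_{ij}z_iz_j+\beta h\sum_{i=1}^N z_i-\frac{\beta^2}{4N}\Big(\sum_{i=1}^N z_i^2\Big)^2+\frac{\lambda}{2}\sum_{i=1}^N z_i^2\Big),$$ and the pressure is $A_N(\beta,\lambda,h)=\frac1N\mathbb E\log Z_N(\beta,\lambda,h;J)$. *)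

theory Defs
  imports "HOL-Probability.Probability"
begin

definition gauss :: "real measure" where
  "gauss = density lborel std_normal_density"

definition gaussN :: "nat \<Rightarrow> (nat \<Rightarrow> real) measure" where
  "gaussN N = PiM {1..N} (\<lambda>_. gauss)"

definition disorder :: "nat \<Rightarrow> (nat \<times> nat \<Rightarrow> real) measure" where
  "disorder N = PiM ({1..N} \<times> {1..N}) (\<lambda>_. gauss)"

definition partition_fn :: "nat \<Rightarrow> real \<Rightarrow> real \<Rightarrow> real \<Rightarrow> (nat \<times> nat \<Rightarrow> real) \<Rightarrow> real" where
  "partition_fn N \<beta> lam h J =
     (\<integral>z. exp (\<beta> / sqrt (2 * real N) * (\<Sum>i\<in>{1..N}. \<Sum>j\<in>{1..N}. J (i, j) * z i * z j)
              + \<beta> * h * (\<Sum>i\<in>{1..N}. z i)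
              - \<beta>\<^sup>2 / (4 * real N) * (\<Sum>i\<in>{1..N}. (z i)\<^sup>2)\<^sup>2
              + lam / 2 * (\<Sum>i\<in>{1..N}. (z i)\<^sup>2)) \<partial>gaussN N)"

definition pressure :: "nat \<Rightarrow> real \<Rightarrow> real \<Rightarrow> real \<Rightarrow> real" where
  "pressure N \<beta> lam h = (1 / real N) * (\<integral>J. ln (partition_fn N \<beta> lam h J) \<partial>disorder N)"

end

theory Submission
  imports Defs
begin

text \<open>
  A Gaussian comparison principle drives the proof: if \<open>X\<close> and \<open>Y\<close> are centred Gaussian
  fields whose covariances satisfy \<open>C\<^sub>X \<le> C\<^sub>Y + D\<close> pointwise, then
  \<open>E log \<integral> exp (X - C\<^sub>X(z,z)/2) d\<mu> \<ge> E log \<integral> exp (Y - C\<^sub>Y(z,z)/2) d\<mu> - D/2\<close>.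
  The quartic term of the Hamiltonian is exactly the half-variance counterterm of the
  interaction. Instead of differentiating an interpolation, the variance of \<open>Y\<close> is
  traded for that of \<open>X\<close> in \<open>n\<close> portions of size \<open>1/n\<close>; by a third-order cumulant expansion
  each trade costs at most \<open>D/(2n) + O(n\<^sup>-\<^sup>3\<^sup>/\<^sup>2)\<close>.

  Applied to the full system against two independent blocks, whose covariances are ordered by
  convexity of \<open>q \<mapsto> q\<^sup>2\<close>, the principle gives superadditivity of \<open>N A\<^sub>N\<close>. Applied to a
  linear field against the full system, using \<open>2 s t \<le> s\<^sup>2 + t\<^sup>2\<close>, it gives a bound on \<open>A\<^sub>N\<close> uniform
  in \<open>N\<close> and valid for every \<open>\<lambda>\<close> (the annealed bound is infinite for \<open>\<lambda> \<ge> 1\<close>).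
  Fekete's lemma concludes. The comparison is carried out with \<open>z\<close> confined to a cube, where
  all fields are bounded, and the cube is then exhausted by monotone convergence.
\<close>

section \<open>Gaussian vectors\<close>

text \<open>Why one trade works: with everything else frozen, a fresh centred portion of size
  \<open>e\<close> adds \<open>e X - e^2/2 Q\<close> to the exponent, where \<open>Q\<close> is the
  variance of \<open>X\<close> at \<open>z\<close>. Averaging the expansion over the Gaussian
  coordinates kills the linear term and cancels the self-overlap against the counterterm. What
  survives is minus \<open>e^2/2\<close> times the covariance averaged over two independent Gibbs
  replicas, so a larger covariance costs more, and the ordering of covariances is needed only under
  the replica integral. The cube secures this: the constant depends only on the number of
  coordinates and on the sup norm of the fields. The slack \<open>D\<close> lets a kernel linear in
  the overlap be compared with a quadratic one. The resulting bound does not depend on the cube and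
  serves twice: the increasing free energies converge as the cube grows, and the supremum in
  Fekete's lemma is finite.\<close>

abbreviation gaussV :: "'i set \<Rightarrow> ('i \<Rightarrow> real) measure" where
  "gaussV I \<equiv> PiM I (\<lambda>_. gauss)"

lemma sets_gauss [measurable_cong, simp]: "sets gauss = sets borel"
  by (simp add: gauss_def)

lemma space_gauss [simp]: "space gauss = UNIV"
  by (simp add: gauss_def)

lemma real_distribution_gauss: "real_distribution gauss"
  unfolding gauss_def by (rule real_dist_normal_dist)

lemma prob_space_gauss: "prob_space gauss"
  using real_distribution_gauss by (simp add: real_distribution_def)

interpretation gauss: prob_space gauss
  by (rule prob_space_gauss)

interpretation gauss_prod: product_prob_space "\<lambda>_. gauss" I for I :: "'i set"
  by unfold_locales

lemma prob_space_gaussV: "prob_space (gaussV I)"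
  by (intro prob_space_PiM prob_space_gauss)

lemma integrable_gauss_exp_abs: "integrable gauss (\<lambda>x. exp (b * \<bar>x\<bar>))"
proof -
  have 1: "integrable gauss (\<lambda>x. exp (c * x))" for c
  proof -
    \<comment> \<open>Completing the square: tilting by \<open>exp (c * x)\<close> moves the mean to
      \<open>c\<close> at the cost of the factor \<open>exp (c^2 / 2)\<close>.\<close>
    have "std_normal_density x * exp (c * x) = exp (c\<^sup>2 / 2) * normal_density c 1 x" for x
      by (simp add: normal_density_def mult_exp_exp power2_eq_square field_simps)
    then show ?thesis
      unfolding gauss_def by (subst integrable_density) auto
  qed
  show ?thesis
  proof (rule Bochner_Integration.integrable_bound)
    show "integrable gauss (\<lambda>x. exp (b * x) + exp (- b * x))"
      using 1[of b] 1[of "-b"] by simp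
    have "exp (b * \<bar>x\<bar>) \<le> exp (b * x) + exp (- b * x)" for x
      by (cases "x \<ge> 0") auto
    then show "AE x in gauss. norm (exp (b * \<bar>x\<bar>)) \<le> norm (exp (b * x) + exp (- b * x))"
      by (intro AE_I2) (simp add: abs_of_pos add_pos_pos)
  qed simp
qed

lemma gauss_moments:
  shows "integrable gauss (\<lambda>x. x)" "integrable gauss (\<lambda>x. x\<^sup>2)"
    and "(\<integral>x. x \<partial>gauss) = 0" "(\<integral>x. x\<^sup>2 \<partial>gauss) = 1"
  using integrable_std_normal_distribution_moment[of 1] integrable_std_normal_distribution_moment[of 2]
    integral_std_normal_distribution_moment_odd[of 1] std_normal_distribution_even_moments(1)[of 1]
  by (simp_all add: gauss_def)

text \<open>Both characteristic functions equal \<open>exp (- t^2 (a^2 + b^2) / 2)\<close>. This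
  route covers \<open>a = b = 0\<close>, where the law is a point mass without density; the trading
  path meets that case, since some coordinates carry no variance near its ends.\<close>

lemma gauss_add:
  "distr (gauss \<Otimes>\<^sub>M gauss) borel (\<lambda>(x, y). a * x + b * y) =
   distr gauss borel (\<lambda>x. sqrt (a\<^sup>2 + b\<^sup>2) * x)"
proof (rule Levy_uniqueness)
  interpret gauss2: pair_prob_space gauss gauss ..
  have [measurable]: "(\<lambda>(x, y). a * x + b * y) \<in> borel_measurable (gauss \<Otimes>\<^sub>M gauss)"
    by measurable
  show "real_distribution (distr (gauss \<Otimes>\<^sub>M gauss) borel (\<lambda>(x, y). a * x + b * y))"
    by (auto simp: real_distribution_def real_distribution_axioms_def intro!: gauss2.prob_space_distr)
  show "real_distribution (distr gauss borel (\<lambda>x. sqrt (a\<^sup>2 + b\<^sup>2) * x))"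
    by (auto simp: real_distribution_def real_distribution_axioms_def intro!: gauss.prob_space_distr)
  have ch: "(CLINT x|gauss. iexp (t * x)) = exp (- (t\<^sup>2) / 2)" for t
    using fun_cong[OF char_std_normal_distribution, of t] by (simp add: char_def gauss_def)
  have int: "integrable gauss (\<lambda>x. iexp (c * x))" for c
    by (rule gauss.integrable_const_bound[of _ 1]) auto
  show "char (distr (gauss \<Otimes>\<^sub>M gauss) borel (\<lambda>(x, y). a * x + b * y)) =
        char (distr gauss borel (\<lambda>x. sqrt (a\<^sup>2 + b\<^sup>2) * x))"
  proof
    fix t
    have "char (distr (gauss \<Otimes>\<^sub>M gauss) borel (\<lambda>(x, y). a * x + b * y)) t =
        (CLINT p|gauss \<Otimes>\<^sub>M gauss. iexp (t * (a * fst p + b * snd p)))"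
      by (simp add: char_def integral_distr case_prod_beta)
    also have "\<dots> = (CLINT x|gauss. CLINT y|gauss. iexp (t * (a * x + b * y)))"
      by (subst gauss2.integral_fst'[symmetric])
         (auto intro!: gauss2.P.integrable_const_bound[of _ 1])
    also have "\<dots> = (CLINT x|gauss. CLINT y|gauss. iexp ((t * a) * x) * iexp ((t * b) * y))"
      by (intro Bochner_Integration.integral_cong refl)
         (simp add: exp_add[symmetric] algebra_simps)
    also have "\<dots> = (CLINT x|gauss. iexp ((t * a) * x)) * (CLINT y|gauss. iexp ((t * b) * y))"
      using int by simp
    also have "\<dots> = exp (- ((t * a)\<^sup>2) / 2) * exp (- ((t * b)\<^sup>2) / 2)"
      unfolding ch by simp
    also have "\<dots> = exp (- ((t * sqrt (a\<^sup>2 + b\<^sup>2))\<^sup>2) / 2)"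
      by (simp add: mult_exp_exp power_mult_distrib field_simps)
    also have "\<dots> = (CLINT x|gauss. iexp ((t * sqrt (a\<^sup>2 + b\<^sup>2)) * x))"
      unfolding ch by simp
    also have "\<dots> = char (distr gauss borel (\<lambda>x. sqrt (a\<^sup>2 + b\<^sup>2) * x)) t"
      by (simp add: char_def integral_distr mult_ac)
    finally show "char (distr (gauss \<Otimes>\<^sub>M gauss) borel (\<lambda>(x, y). a * x + b * y)) t =
      char (distr gauss borel (\<lambda>x. sqrt (a\<^sup>2 + b\<^sup>2) * x)) t" .
  qed
qed

lemma emeasure_distr_indicator:
  assumes [measurable]: "f \<in> M \<rightarrow>\<^sub>M N" "A \<in> sets N"
  shows "emeasure (distr M N f) A = (\<integral>\<^sup>+x. indicator A (f x) \<partial>M)"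
proof -
  have "emeasure (distr M N f) A = (\<integral>\<^sup>+y. indicator A y \<partial>distr M N f)"
    by simp
  also have "\<dots> = (\<integral>\<^sup>+x. indicator A (f x) \<partial>M)"
    by (rule nn_integral_distr) auto
  finally show ?thesis .
qed

text \<open>Both sides are identified with the product of the one-dimensional laws
  \<open>M i\<close>: it suffices to test rectangles, whose indicators factor over the coordinates.
  Read from right to left, this splits a Gaussian vector of variances \<open>a^2 + b^2\<close> into
  two independent layers, one to be frozen and one to be expanded.\<close>

lemma gaussV_add:
  fixes a b :: "'i \<Rightarrow> real"
  assumes fin: "finite I"
  shows "distr (gaussV I \<Otimes>\<^sub>M gaussV I) (gaussV I) (\<lambda>(x, y). \<lambda>i\<in>I. a i * x i + b i * y i) =
    distr (gaussV I) (gaussV I) (\<lambda>x. \<lambda>i\<in>I. sqrt ((a i)\<^sup>2 + (b i)\<^sup>2) * x i)"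
    (is "?L = ?R")
proof -
  define c where "c i = sqrt ((a i)\<^sup>2 + (b i)\<^sup>2)" for i
  define M where "M i = distr gauss borel (\<lambda>x. c i * x)" for i
  note sfV = prob_space_imp_sigma_finite[OF prob_space_gaussV]
  interpret gauss2: pair_prob_space gauss gauss ..
  have pM: "prob_space (M i)" for i
    unfolding M_def by (rule gauss.prob_space_distr) simp
  interpret M: product_prob_space M I
    using pM by (simp add: product_prob_space_def product_prob_space_axioms_def
        product_sigma_finite_def prob_space_imp_sigma_finite)
  have [simp]: "sets (M i) = sets borel" for i by (simp add: M_def)
  have setsM: "sets (PiM I M) = sets (gaussV I)"
    by (rule sets_PiM_cong) auto
  have mL [measurable]: "(\<lambda>(x, y). \<lambda>i\<in>I. a i * x i + b i * y i) \<in> gaussV I \<Otimes>\<^sub>M gaussV I \<rightarrow>\<^sub>M gaussV I"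
    unfolding case_prod_beta by (rule measurable_restrict) measurable
  have mR [measurable]: "(\<lambda>x. \<lambda>i\<in>I. c i * x i) \<in> gaussV I \<rightarrow>\<^sub>M gaussV I"
    by (rule measurable_restrict) measurable
  have prodind: "indicator (Pi\<^sub>E I A) (\<lambda>i\<in>I. f i) = (\<Prod>i\<in>I. indicator (A i) (f i) :: ennreal)"
    for A :: "'i \<Rightarrow> real set" and f
  proof (cases "\<forall>i\<in>I. f i \<in> A i")
    case True
    then show ?thesis by (auto simp: indicator_def)
  next
    case False
    then obtain i where i: "i \<in> I" "f i \<notin> A i" by auto
    then have "(\<lambda>i\<in>I. f i) \<notin> Pi\<^sub>E I A" by (auto dest: PiE_mem)
    moreover have "(\<Prod>i\<in>I. indicator (A i) (f i) :: ennreal) = 0"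
      using i fin by (intro prod_zero) (auto simp: indicator_def)
    ultimately show ?thesis by simp
  qed
  have L: "?L = PiM I M"
  proof (rule M.PiM_eqI)
    fix A assume "\<And>i. i \<in> I \<Longrightarrow> A i \<in> sets (M i)"
    then have [measurable]: "\<And>i. i \<in> I \<Longrightarrow> A i \<in> sets borel" by simp
    then have A: "Pi\<^sub>E I A \<in> sets (gaussV I)"
      using fin by (intro sets_PiM_I_finite) auto
    have "emeasure ?L (Pi\<^sub>E I A) = (\<integral>\<^sup>+p. indicator (Pi\<^sub>E I A) (\<lambda>i\<in>I. a i * fst p i + b i * snd p i) \<partial>(gaussV I \<Otimes>\<^sub>M gaussV I))"
      using A by (simp add: emeasure_distr_indicator case_prod_beta)
    also have "\<dots> = (\<integral>\<^sup>+p. (\<Prod>i\<in>I. indicator (A i) (a i * fst p i + b i * snd p i)) \<partial>(gaussV I \<Otimes>\<^sub>M gaussV I))"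
      unfolding prodind ..
    also have "\<dots> = (\<integral>\<^sup>+x. \<integral>\<^sup>+y. (\<Prod>i\<in>I. indicator (A i) (a i * x i + b i * y i)) \<partial>gaussV I \<partial>gaussV I)"
      by (subst sigma_finite_measure.nn_integral_fst[OF sfV, symmetric]) auto
    also have "\<dots> = (\<integral>\<^sup>+x. (\<Prod>i\<in>I. \<integral>\<^sup>+y. indicator (A i) (a i * x i + b i * y) \<partial>gauss) \<partial>gaussV I)"
      by (intro nn_integral_cong gauss_prod.product_nn_integral_prod fin) auto
    also have "\<dots> = (\<Prod>i\<in>I. \<integral>\<^sup>+x. \<integral>\<^sup>+y. indicator (A i) (a i * x + b i * y) \<partial>gauss \<partial>gauss)"
      by (intro gauss_prod.product_nn_integral_prod fin) auto
    also have "\<dots> = (\<Prod>i\<in>I. emeasure (M i) (A i))"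
    proof (rule prod.cong[OF refl])
      fix i assume i: "i \<in> I"
      have [measurable]: "A i \<in> sets borel" using i by simp
      have "(\<integral>\<^sup>+x. \<integral>\<^sup>+y. indicator (A i) (a i * x + b i * y) \<partial>gauss \<partial>gauss) =
        (\<integral>\<^sup>+p. indicator (A i) (a i * fst p + b i * snd p) \<partial>(gauss \<Otimes>\<^sub>M gauss))"
        by (subst gauss.nn_integral_fst[symmetric]) auto
      also have "\<dots> = emeasure (distr (gauss \<Otimes>\<^sub>M gauss) borel (\<lambda>(x, y). a i * x + b i * y)) (A i)"
        by (simp add: emeasure_distr_indicator case_prod_beta)
      finally show "(\<integral>\<^sup>+x. \<integral>\<^sup>+y. indicator (A i) (a i * x + b i * y) \<partial>gauss \<partial>gauss) = emeasure (M i) (A i)"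
        by (simp add: M_def gauss_add c_def)
    qed
    finally show "emeasure ?L (Pi\<^sub>E I A) = (\<Prod>i\<in>I. emeasure (M i) (A i))" .
  qed (use fin setsM in auto)
  have R: "distr (gaussV I) (gaussV I) (\<lambda>x. \<lambda>i\<in>I. c i * x i) = PiM I M" (is "?R' = _")
  proof (rule M.PiM_eqI)
    fix A assume "\<And>i. i \<in> I \<Longrightarrow> A i \<in> sets (M i)"
    then have [measurable]: "\<And>i. i \<in> I \<Longrightarrow> A i \<in> sets borel" by simp
    then have A: "Pi\<^sub>E I A \<in> sets (gaussV I)"
      using fin by (intro sets_PiM_I_finite) auto
    have "emeasure ?R' (Pi\<^sub>E I A) = (\<integral>\<^sup>+x. indicator (Pi\<^sub>E I A) (\<lambda>i\<in>I. c i * x i) \<partial>gaussV I)"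
      using A by (simp add: emeasure_distr_indicator)
    also have "\<dots> = (\<Prod>i\<in>I. \<integral>\<^sup>+x. indicator (A i) (c i * x) \<partial>gauss)"
      unfolding prodind by (intro gauss_prod.product_nn_integral_prod fin) auto
    also have "\<dots> = (\<Prod>i\<in>I. emeasure (M i) (A i))"
      by (intro prod.cong refl) (simp add: M_def emeasure_distr_indicator)
    finally show "emeasure ?R' (Pi\<^sub>E I A) = (\<Prod>i\<in>I. emeasure (M i) (A i))" .
  qed (use fin setsM in auto)
  show ?thesis using L R by (simp add: c_def)
qed

lemma integrable_gaussV_exp_abs:
  assumes "finite I"
  shows "integrable (gaussV I) (\<lambda>x. exp (b * (\<Sum>i\<in>I. \<bar>x i\<bar>)))"
proof -
  have "integrable (gaussV I) (\<lambda>x. \<Prod>i\<in>I. exp (b * \<bar>x i\<bar>))"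
    by (intro gauss_prod.product_integrable_prod assms integrable_gauss_exp_abs)
  then show ?thesis
    by (simp add: exp_sum[OF assms] sum_distrib_left)
qed

lemma gaussV_moments:
  assumes fin: "finite I" and ij: "i \<in> I" "j \<in> I"
  shows "integrable (gaussV I) (\<lambda>x. x i)" "(\<integral>x. x i \<partial>gaussV I) = 0"
    and "integrable (gaussV I) (\<lambda>x. x i * x j)" "(\<integral>x. x i * x j \<partial>gaussV I) = (if i = j then 1 else 0)"
proof -
  \<comment> \<open>A coordinate is written as a product over all of \<open>I\<close> whose other
    factors are 1, the form to which integration of products over coordinates applies.\<close>
  have *: "(\<Prod>k\<in>I. if k = l then x k else 1) = x l" if "l \<in> I" for x :: "'a \<Rightarrow> real" and l
    using fin that by simp
  have int1: "integrable gauss (\<lambda>x. if k = l then x else 1)" for k l :: 'a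
    using gauss_moments by (cases "k = l") auto
  show "integrable (gaussV I) (\<lambda>x. x i)"
    using gauss_prod.product_integrable_prod[OF fin, of "\<lambda>k x. if k = i then x else 1"] int1
    by (simp add: * ij cong: if_cong)
  show "(\<integral>x. x i \<partial>gaussV I) = 0"
  proof -
    have "(\<integral>x. x i \<partial>gaussV I) = (\<integral>x. (\<Prod>k\<in>I. if k = i then x k else 1) \<partial>gaussV I)"
      using * [OF ij(1)] by simp
    also have "\<dots> = (\<Prod>k\<in>I. \<integral>x. (if k = i then x else 1) \<partial>gauss)"
      by (rule gauss_prod.product_integral_prod[OF fin int1])
    also have "\<dots> = 0"
      by (rule prod_zero[OF fin]) (use ij gauss_moments(3) in \<open>auto intro: bexI[of _ i]\<close>)
    finally show ?thesis .
  qed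
  \<comment> \<open>One family of factors serves both cases: it yields a square at
    \<open>i = j\<close> and two single coordinates otherwise.\<close>
  define f :: "'a \<Rightarrow> real \<Rightarrow> real"
    where "f k x = (if k = i then x else 1) * (if k = j then x else 1)" for k x
  have fk: "f k = (if k = i \<and> k = j then (\<lambda>x. x\<^sup>2) else if k = i \<or> k = j then (\<lambda>x. x) else (\<lambda>x. 1))" for k
    by (auto simp: f_def power2_eq_square fun_eq_iff)
  have int2: "integrable gauss (f k)" for k
    unfolding fk using gauss_moments(1,2) by (simp split: if_split)
  have prod: "(\<Prod>k\<in>I. f k (x k)) = x i * x j" for x
    using ij by (simp add: f_def prod.distrib * )
  show "integrable (gaussV I) (\<lambda>x. x i * x j)"
    using gauss_prod.product_integrable_prod[OF fin, of f] int2 by (simp add: prod)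
  have "(\<integral>x. x i * x j \<partial>gaussV I) = (\<Prod>k\<in>I. integral\<^sup>L gauss (f k))"
    using gauss_prod.product_integral_prod[OF fin, of f] int2 by (simp add: prod)
  also have "\<dots> = (if i = j then 1 else 0)"
  proof (cases "i = j")
    case True
    then have "integral\<^sup>L gauss (f k) = 1" for k
      unfolding fk using gauss_moments(4) gauss.prob_space True by (simp split: if_split)
    then show ?thesis using True by simp
  next
    case False
    then have "integral\<^sup>L gauss (f i) = 0"
      unfolding fk using gauss_moments(3) by simp
    then show ?thesis using False fin ij by (auto simp: prod_zero_iff)
  qed
  finally show "(\<integral>x. x i * x j \<partial>gaussV I) = (if i = j then 1 else 0)" .
qed

section \<open>Third-order expansion of the log moment generating function\<close>

lemma exp_taylor3:
  fixes x :: real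
  assumes "\<bar>x\<bar> \<le> 1 / 2"
  shows "\<bar>exp x - 1 - x - x\<^sup>2 / 2\<bar> \<le> \<bar>x\<bar> ^ 3"
proof -
  obtain t where t: "\<bar>t\<bar> \<le> \<bar>x\<bar>" "exp x = (\<Sum>m<3. x ^ m / fact m) + exp t / fact 3 * x ^ 3"
    using Maclaurin_exp_le by blast
  have "exp t \<le> exp 1"
    using t(1) assms by simp
  also have "\<dots> \<le> 3"
    by (rule exp_le)
  finally have *: "exp t / 6 \<le> 1" by simp
  have "exp x - 1 - x - x\<^sup>2 / 2 = exp t / 6 * x ^ 3"
    using t(2) by (simp add: numeral_3_eq_3 power2_eq_square fact_numeral)
  then have "\<bar>exp x - 1 - x - x\<^sup>2 / 2\<bar> = exp t / 6 * \<bar>x\<bar> ^ 3"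
    by (simp only: abs_mult power_abs) simp
  also have "\<dots> \<le> 1 * \<bar>x\<bar> ^ 3"
    using * by (intro mult_right_mono) auto
  finally show ?thesis by simp
qed

lemma (in prob_space) abs_expectation_le:
  fixes f :: "'a \<Rightarrow> real"
  assumes "f \<in> borel_measurable M" "\<And>z. z \<in> space M \<Longrightarrow> \<bar>f z\<bar> \<le> m"
  shows "integrable M f" "\<bar>expectation f\<bar> \<le> m"
proof -
  show i: "integrable M f"
    using assms by (intro integrable_const_bound[of _ m]) auto
  have "\<bar>expectation f\<bar> \<le> expectation (\<lambda>z. \<bar>f z\<bar>)"
    by (rule integral_abs_bound)
  also have "\<dots> \<le> expectation (\<lambda>z. m)"
    using i assms by (intro integral_mono) auto
  finally show "\<bar>expectation f\<bar> \<le> m"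
    by (simp add: prob_space)
qed

lemma (in finite_measure) ln_integral_exp_bound:
  fixes v :: "'a \<Rightarrow> real"
  assumes [measurable]: "v \<in> borel_measurable M" and m: "\<And>z. z \<in> space M \<Longrightarrow> \<bar>v z\<bar> \<le> m"
    and pos: "0 < measure M (space M)"
  shows "integrable M (\<lambda>z. exp (v z))" "0 < (\<integral>z. exp (v z) \<partial>M)"
    and "\<bar>ln (\<integral>z. exp (v z) \<partial>M) - ln (measure M (space M))\<bar> \<le> m"
proof -
  show i: "integrable M (\<lambda>z. exp (v z))"
    using m by (intro integrable_const_bound[of _ "exp m"]) (auto simp: abs_le_iff)
  have "(\<integral>z. exp (- m) \<partial>M) \<le> (\<integral>z. exp (v z) \<partial>M)"
    using i m by (intro integral_mono) (auto simp: abs_le_iff minus_le_iff)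
  then have 1: "exp (- m) * measure M (space M) \<le> (\<integral>z. exp (v z) \<partial>M)"
    by (simp add: mult.commute)
  have "(\<integral>z. exp (v z) \<partial>M) \<le> (\<integral>z. exp m \<partial>M)"
    using i m by (intro integral_mono) (auto simp: abs_le_iff)
  then have 2: "(\<integral>z. exp (v z) \<partial>M) \<le> exp m * measure M (space M)"
    by (simp add: mult.commute)
  show p: "0 < (\<integral>z. exp (v z) \<partial>M)"
    using 1 pos by (smt (verit) exp_gt_zero mult_pos_pos)
  have "ln (exp (- m) * measure M (space M)) \<le> ln (\<integral>z. exp (v z) \<partial>M)"
    using 1 p pos by (subst ln_le_cancel_iff) auto
  moreover have "ln (\<integral>z. exp (v z) \<partial>M) \<le> ln (exp m * measure M (space M))"
    using 2 p pos by (subst ln_le_cancel_iff) auto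
  ultimately show "\<bar>ln (\<integral>z. exp (v z) \<partial>M) - ln (measure M (space M))\<bar> \<le> m"
    using pos by (simp add: ln_mult)
qed

text \<open>The logarithm itself is never expanded. The Taylor bound for \<open>exp\<close> is
  applied to \<open>v\<close> under the integral and to the number \<open>l\<close>; both contain
  the same \<open>exp l\<close>, so \<open>l + l^2/2\<close> agrees with \<open>a + q/2\<close> up
  to \<open>2 m^3\<close>. For \<open>m\<close> above 1/2 the claim is a crude size estimate; large
  \<open>m\<close> must be covered because \<open>m\<close> will grow with the unbounded Gaussian
  coordinates.\<close>

lemma (in prob_space) ln_mgf_expansion:
  fixes v :: "'a \<Rightarrow> real"
  assumes [measurable]: "v \<in> borel_measurable M" and m: "\<And>z. z \<in> space M \<Longrightarrow> \<bar>v z\<bar> \<le> m"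
  shows "\<bar>ln (expectation (\<lambda>z. exp (v z))) - expectation v
    - (expectation (\<lambda>z. (v z)\<^sup>2) - (expectation v)\<^sup>2) / 2\<bar> \<le> 10 * m ^ 3"
proof -
  define l where "l = ln (expectation (\<lambda>z. exp (v z)))"
  define a where "a = expectation v"
  define q where "q = expectation (\<lambda>z. (v z)\<^sup>2)"
  have m0: "m \<ge> 0"
    using m[of "SOME z. z \<in> space M"] not_empty by (meson abs_ge_zero equals0I m order_trans)
  have l: "\<bar>l\<bar> \<le> m"
    using ln_integral_exp_bound(3)[OF assms] by (simp add: l_def prob_space)
  have pos: "expectation (\<lambda>z. exp (v z)) > 0"
    using ln_integral_exp_bound(2)[OF assms] by (simp add: prob_space)
  have a: "\<bar>a\<bar> \<le> m" and ia: "integrable M v"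
    unfolding a_def using m by (auto intro!: abs_expectation_le)
  have sq: "\<bar>(v z)\<^sup>2\<bar> \<le> m\<^sup>2" if "z \<in> space M" for z
    using power_mono[OF m[OF that], of 2] by simp
  have iq: "integrable M (\<lambda>z. (v z)\<^sup>2)"
    by (rule abs_expectation_le(1)[OF _ sq]) simp
  have q: "\<bar>q\<bar> \<le> m\<^sup>2"
    unfolding q_def by (rule abs_expectation_le(2)[OF _ sq]) simp
  have q0: "q \<ge> 0"
    unfolding q_def by simp
  have "\<bar>l - a - (q - a\<^sup>2) / 2\<bar> \<le> 10 * m ^ 3"
  proof (cases "m \<le> 1 / 2")
    case True
    have ie: "integrable M (\<lambda>z. exp (v z))"
      using m by (intro abs_expectation_le(1)[of _ "exp m"]) (auto simp: abs_le_iff)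
    have "\<bar>expectation (\<lambda>z. exp (v z) - 1 - v z - (v z)\<^sup>2 / 2)\<bar> \<le> m ^ 3"
    proof (rule abs_expectation_le)
      fix z assume z: "z \<in> space M"
      have "\<bar>exp (v z) - 1 - v z - (v z)\<^sup>2 / 2\<bar> \<le> \<bar>v z\<bar> ^ 3"
        using m[OF z] True by (intro exp_taylor3) auto
      also have "\<dots> \<le> m ^ 3"
        using m[OF z] by (intro power_mono) auto
      finally show "\<bar>exp (v z) - 1 - v z - (v z)\<^sup>2 / 2\<bar> \<le> m ^ 3" .
    qed simp
    also have "expectation (\<lambda>z. exp (v z) - 1 - v z - (v z)\<^sup>2 / 2) = exp l - 1 - a - q / 2"
      using ie ia iq pos by (simp add: a_def q_def l_def prob_space)
    finally have 1: "\<bar>exp l - 1 - a - q / 2\<bar> \<le> m ^ 3" .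
    have "\<bar>exp l - 1 - l - l\<^sup>2 / 2\<bar> \<le> \<bar>l\<bar> ^ 3"
      using l True by (intro exp_taylor3) auto
    also have "\<dots> \<le> m ^ 3"
      using l by (intro power_mono) auto
    finally have 2: "\<bar>exp l - 1 - l - l\<^sup>2 / 2\<bar> \<le> m ^ 3" .
    have 3: "\<bar>l + l\<^sup>2 / 2 - a - q / 2\<bar> \<le> 2 * m ^ 3"
      using 1 2 by linarith
    have l2: "l\<^sup>2 \<le> m\<^sup>2"
      using l m0 by (simp add: abs_le_square_iff[symmetric])
    have m3: "2 * m ^ 3 \<le> m\<^sup>2"
      using True m0 mult_right_mono[of "2 * m" 1 "m\<^sup>2"] by (simp add: power3_eq_cube power2_eq_square)
    \<comment> \<open>Second-order closeness of \<open>l\<close> and \<open>a\<close> is enough: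
      multiplied by \<open>\<bar>l + a\<bar> \<le> 2 * m\<close>, it replaces \<open>l^2\<close> by
      \<open>a^2\<close> at third order.\<close>
    have "\<bar>l - a\<bar> \<le> 2 * m\<^sup>2"
      using 3 l2 m3 q q0 zero_le_power2[of l] by linarith
    moreover have "\<bar>l + a\<bar> \<le> 2 * m"
      using l a by linarith
    ultimately have "\<bar>l - a\<bar> * \<bar>l + a\<bar> \<le> (2 * m\<^sup>2) * (2 * m)"
      by (intro mult_mono) auto
    then have "\<bar>l\<^sup>2 - a\<^sup>2\<bar> \<le> 4 * m ^ 3"
      by (simp add: abs_mult[symmetric] power2_eq_square power3_eq_cube algebra_simps)
    have eq: "l - a - (q - a\<^sup>2) / 2 = (l + l\<^sup>2 / 2 - a - q / 2) - (l\<^sup>2 - a\<^sup>2) / 2"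
      by (simp add: field_simps)
    have "\<bar>r - s / 2\<bar> \<le> 10 * k" if "\<bar>r\<bar> \<le> 2 * k" "\<bar>s\<bar> \<le> 4 * k" "0 \<le> k" for r s k :: real
      using that by linarith
    then show ?thesis
      unfolding eq using 3 \<open>\<bar>l\<^sup>2 - a\<^sup>2\<bar> \<le> 4 * m ^ 3\<close> zero_le_power[OF m0, of 3] by blast
  next
    case False
    then have m1: "1 \<le> 4 * m\<^sup>2"
      using mult_mono[of "1/2" m "1/2" m] by (simp add: power2_eq_square)
    have a2: "a\<^sup>2 \<le> m\<^sup>2"
      using a m0 by (simp add: abs_le_square_iff[symmetric])
    have "\<bar>l - a - (q - a\<^sup>2) / 2\<bar> \<le> 2 * m + m\<^sup>2 / 2"
    proof -
      have "\<bar>r - s - (t - u) / 2\<bar> \<le> 2 * k + w / 2"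
        if "\<bar>r\<bar> \<le> k" "\<bar>s\<bar> \<le> k" "0 \<le> t" "t \<le> w" "0 \<le> u" "u \<le> w" for r s t u k w :: real
        unfolding diff_divide_distrib using that by linarith
      then show ?thesis
        using l a q q0 a2 by simp
    qed
    \<comment> \<open>This branch dictates the size of the constant: \<open>2 m\<close> is at most
      \<open>8 m^3\<close> and \<open>m^2 / 2\<close> at most \<open>m^3\<close>. The other branch
      needs only 4.\<close>
    also have "\<dots> \<le> 10 * m ^ 3"
    proof -
      have "2 * m * 1 \<le> 2 * m * (4 * m\<^sup>2)"
        using m1 m0 by (intro mult_left_mono) auto
      moreover have "m\<^sup>2 * 1 \<le> m\<^sup>2 * (2 * m)"
        using False by (intro mult_left_mono) auto
      ultimately show ?thesis
        using zero_le_power[OF m0, of 3] by (simp add: power3_eq_cube power2_eq_square algebra_simps)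
    qed
    finally show ?thesis .
  qed
  then show ?thesis by (simp add: l_def a_def q_def)
qed

text \<open>Only terms up to order \<open>e^2\<close> are kept, so the main part is a quadratic
  polynomial in \<open>x\<close> that can be integrated by moments. \<open>T\<close> dominates both
  \<open>\<bar>X\<bar>\<close> and \<open>Q\<close>, satisfies
  \<open>\<bar>v\<bar> \<le> e * T\<close>, and is at least 1 so that \<open>T^2\<close> is absorbed
  by \<open>T^3\<close>. In use it is affine in the \<open>\<bar>x a\<bar>\<close>, hence has a
  Gaussian third moment. The 12 is 10 from \<open>ln_mgf_expansion\<close> plus 2 from the cross
  terms.\<close>

lemma (in prob_space) ln_mgf_field_expansion:
  assumes fin: "finite A"
    and [measurable]: "\<And>a. a \<in> A \<Longrightarrow> \<phi> a \<in> borel_measurable M"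
    and b: "\<And>a z. a \<in> A \<Longrightarrow> z \<in> space M \<Longrightarrow> \<bar>\<phi> a z\<bar> \<le> b"
    and b0: "b \<ge> 0" and e: "0 \<le> e" "e \<le> 1"
    and T: "1 + b * (\<Sum>a\<in>A. \<bar>x a\<bar>) + real (card A) * b\<^sup>2 \<le> T"
  shows "\<bar>ln (expectation (\<lambda>z. exp (e * (\<Sum>a\<in>A. x a * \<phi> a z) - e\<^sup>2 / 2 * (\<Sum>a\<in>A. (\<phi> a z)\<^sup>2))))
    - (e * (\<Sum>a\<in>A. x a * expectation (\<phi> a)) - e\<^sup>2 / 2 * (\<Sum>a\<in>A. expectation (\<lambda>z. (\<phi> a z)\<^sup>2))
       + e\<^sup>2 / 2 * (\<Sum>a\<in>A. \<Sum>c\<in>A. x a * x c *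
          (expectation (\<lambda>z. \<phi> a z * \<phi> c z) - expectation (\<phi> a) * expectation (\<phi> c))))\<bar>
    \<le> 12 * e ^ 3 * T ^ 3"
    and "\<And>z. z \<in> space M \<Longrightarrow>
      \<bar>e * (\<Sum>a\<in>A. x a * \<phi> a z) - e\<^sup>2 / 2 * (\<Sum>a\<in>A. (\<phi> a z)\<^sup>2)\<bar> \<le> e * T"
proof -
  define X where "X z = (\<Sum>a\<in>A. x a * \<phi> a z)" for z
  define Q where "Q z = (\<Sum>a\<in>A. (\<phi> a z)\<^sup>2)" for z
  define v where "v z = e * X z - e\<^sup>2 / 2 * Q z" for z
  have [measurable]: "X \<in> borel_measurable M" "Q \<in> borel_measurable M"
    unfolding X_def Q_def by measurable
  then have [measurable]: "v \<in> borel_measurable M" unfolding v_def by measurable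
  have nn: "0 \<le> b * (\<Sum>a\<in>A. \<bar>x a\<bar>)" "0 \<le> real (card A) * b\<^sup>2"
    using b0 by (auto intro!: mult_nonneg_nonneg sum_nonneg)
  then have T1: "T \<ge> 1" using T by linarith
  have Xb: "\<bar>X z\<bar> \<le> b * (\<Sum>a\<in>A. \<bar>x a\<bar>)" if "z \<in> space M" for z
  proof -
    have "\<bar>X z\<bar> \<le> (\<Sum>a\<in>A. \<bar>x a * \<phi> a z\<bar>)"
      unfolding X_def by (rule sum_abs)
    also have "\<dots> \<le> (\<Sum>a\<in>A. b * \<bar>x a\<bar>)"
      using b[OF _ that] by (intro sum_mono) (simp add: abs_mult mult.commute[of b] mult_left_mono)
    finally show ?thesis by (simp add: sum_distrib_left)
  qed
  have Q0: "0 \<le> Q z" for z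
    unfolding Q_def by (intro sum_nonneg) auto
  have Qb: "Q z \<le> real (card A) * b\<^sup>2" if "z \<in> space M" for z
    unfolding Q_def using b[OF _ that] b0
    by (intro sum_bounded_above) (auto simp: abs_le_square_iff[symmetric])
  have XT: "\<bar>X z\<bar> \<le> T" and QT: "\<bar>Q z\<bar> \<le> T" if "z \<in> space M" for z
    using Xb[OF that] Qb[OF that] Q0[of z] T nn by linarith+
  have e2: "e\<^sup>2 \<le> e" using e by (simp add: power2_eq_square mult_left_le)
  have vT: "\<bar>v z\<bar> \<le> e * T" if "z \<in> space M" for z
  proof -
    have "\<bar>v z\<bar> \<le> e * \<bar>X z\<bar> + e\<^sup>2 / 2 * Q z"
      unfolding v_def using e Q0[of z] abs_triangle_ineq4[of "e * X z" "e\<^sup>2 / 2 * Q z"]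
      by (simp add: abs_mult)
    also have "\<dots> \<le> e * (b * (\<Sum>a\<in>A. \<bar>x a\<bar>)) + e * (real (card A) * b\<^sup>2)"
      using e e2 Q0[of z] Xb[OF that] Qb[OF that]
      by (intro add_mono mult_mono) (auto intro: order_trans[of _ "e\<^sup>2"])
    also have "\<dots> \<le> e * T"
      using T e unfolding distrib_left[symmetric] by (intro mult_left_mono) auto
    finally show ?thesis .
  qed
  then show "\<And>z. z \<in> space M \<Longrightarrow>
      \<bar>e * (\<Sum>a\<in>A. x a * \<phi> a z) - e\<^sup>2 / 2 * (\<Sum>a\<in>A. (\<phi> a z)\<^sup>2)\<bar> \<le> e * T"
    by (simp add: v_def X_def Q_def)
  have prodT: "\<bar>r * s\<bar> \<le> T\<^sup>2" if "\<bar>r\<bar> \<le> T" "\<bar>s\<bar> \<le> T" for r s :: real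
    using mult_mono[OF that] T1 by (simp add: abs_mult power2_eq_square)
  have prodE: "integrable M (\<lambda>z. f z * g z)" "\<bar>expectation (\<lambda>z. f z * g z)\<bar> \<le> T\<^sup>2"
    if "f \<in> borel_measurable M" "g \<in> borel_measurable M"
      "\<And>z. z \<in> space M \<Longrightarrow> \<bar>f z\<bar> \<le> T" "\<And>z. z \<in> space M \<Longrightarrow> \<bar>g z\<bar> \<le> T" for f g
    using abs_expectation_le[of "\<lambda>z. f z * g z" "T\<^sup>2"] prodT that by auto
  have iX: "integrable M X" "\<bar>expectation X\<bar> \<le> T"
    using XT by (auto intro!: abs_expectation_le)
  have iQ: "integrable M Q" "\<bar>expectation Q\<bar> \<le> T"
    using QT by (auto intro!: abs_expectation_le)
  have iXX: "integrable M (\<lambda>z. X z * X z)" "\<bar>expectation (\<lambda>z. X z * X z)\<bar> \<le> T\<^sup>2"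
    by (rule prodE; simp add: XT QT)+
  have iXQ: "integrable M (\<lambda>z. X z * Q z)" "\<bar>expectation (\<lambda>z. X z * Q z)\<bar> \<le> T\<^sup>2"
    by (rule prodE; simp add: XT QT)+
  have iQQ: "integrable M (\<lambda>z. Q z * Q z)" "\<bar>expectation (\<lambda>z. Q z * Q z)\<bar> \<le> T\<^sup>2"
    by (rule prodE; simp add: XT QT)+
  have i\<phi>: "integrable M (\<phi> a)" if "a \<in> A" for a
    using b that by (intro abs_expectation_le(1)[of _ b]) auto
  have i\<phi>\<phi>: "integrable M (\<lambda>z. \<phi> a z * \<phi> c z)" if "a \<in> A" "c \<in> A" for a c
    using b[OF that(1)] b[OF that(2)] that b0
    by (intro abs_expectation_le(1)[of _ "b * b"]) (auto simp: abs_mult intro!: mult_mono)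
  have i\<phi>2: "integrable M (\<lambda>z. (\<phi> a z)\<^sup>2)" if "a \<in> A" for a
    using i\<phi>\<phi>[OF that that] by (simp add: power2_eq_square)
  have EX: "expectation X = (\<Sum>a\<in>A. x a * expectation (\<phi> a))"
    unfolding X_def using i\<phi> by (subst Bochner_Integration.integral_sum) auto
  have EQ: "expectation Q = (\<Sum>a\<in>A. expectation (\<lambda>z. (\<phi> a z)\<^sup>2))"
    unfolding Q_def using i\<phi>2 by (subst Bochner_Integration.integral_sum) auto
  have "expectation (\<lambda>z. X z * X z) = expectation (\<lambda>z. \<Sum>a\<in>A. \<Sum>c\<in>A. x a * x c * (\<phi> a z * \<phi> c z))"
    unfolding X_def sum_product by (intro Bochner_Integration.integral_cong refl sum.cong) (simp add: mult_ac)
  also have "\<dots> = (\<Sum>a\<in>A. \<Sum>c\<in>A. x a * x c * expectation (\<lambda>z. \<phi> a z * \<phi> c z))"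
    using i\<phi>\<phi> by (simp add: Bochner_Integration.integral_sum)
  finally have EXX: "expectation (\<lambda>z. X z * X z) = (\<Sum>a\<in>A. \<Sum>c\<in>A. x a * x c * expectation (\<lambda>z. \<phi> a z * \<phi> c z))" .
  have EX2: "expectation X * expectation X = (\<Sum>a\<in>A. \<Sum>c\<in>A. x a * x c * (expectation (\<phi> a) * expectation (\<phi> c)))"
    unfolding EX sum_product by (intro sum.cong refl) (simp add: mult_ac)
  have Ev: "expectation v = e * expectation X - e\<^sup>2 / 2 * expectation Q"
    unfolding v_def using iX iQ by simp
  have "expectation (\<lambda>z. (v z)\<^sup>2) = expectation (\<lambda>z. e\<^sup>2 * (X z * X z) - e ^ 3 * (X z * Q z) + e ^ 4 / 4 * (Q z * Q z))"
    unfolding v_def by (intro Bochner_Integration.integral_cong refl)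
      (simp add: power2_eq_square power3_eq_cube power4_eq_xxxx field_simps)
  also have "\<dots> = e\<^sup>2 * expectation (\<lambda>z. X z * X z) - e ^ 3 * expectation (\<lambda>z. X z * Q z) + e ^ 4 / 4 * expectation (\<lambda>z. Q z * Q z)"
    using iXX iXQ iQQ by simp
  finally have Ev2: "expectation (\<lambda>z. (v z)\<^sup>2) = \<dots>" .
  \<comment> \<open>\<open>R1\<close> is the covariance of \<open>X\<close> and \<open>Q\<close>,
    and \<open>R2\<close> the variance of \<open>Q\<close>; they carry the parts of order
    \<open>e^3\<close> and \<open>e^4\<close> in the variance of \<open>v\<close>.\<close>
  define R1 where "R1 = expectation (\<lambda>z. X z * Q z) - expectation X * expectation Q"
  define R2 where "R2 = expectation (\<lambda>z. Q z * Q z) - expectation Q * expectation Q"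
  have "\<bar>R1\<bar> \<le> 2 * T\<^sup>2"
    unfolding R1_def using iXQ(2) prodT[OF iX(2) iQ(2)] by linarith
  moreover have "\<bar>R2\<bar> \<le> 2 * T\<^sup>2"
    unfolding R2_def using iQQ(2) prodT[OF iQ(2) iQ(2)] by linarith
  ultimately have R: "\<bar>R1\<bar> \<le> 2 * T ^ 3" "\<bar>R2\<bar> \<le> 2 * T ^ 3"
    using power_increasing[of 2 3 T] T1 by linarith+
  have e43: "e ^ 4 \<le> e ^ 3" using e by (intro power_decreasing) auto
  have "\<bar>e ^ 3 * R1\<bar> \<le> e ^ 3 * (2 * T ^ 3)"
    using R e by (simp add: abs_mult mult_left_mono)
  moreover have "\<bar>e ^ 4 * R2\<bar> \<le> e ^ 3 * (2 * T ^ 3)"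
    unfolding abs_mult using R e e43 by (intro mult_mono) auto
  ultimately have rem: "\<bar>e ^ 4 * R2 / 8 - e ^ 3 * R1 / 2\<bar> \<le> 2 * (e ^ 3 * T ^ 3)"
    by linarith
  have var: "(expectation (\<lambda>z. (v z)\<^sup>2) - (expectation v)\<^sup>2) / 2 =
     e\<^sup>2 / 2 * (expectation (\<lambda>z. X z * X z) - expectation X * expectation X)
     + (e ^ 4 * R2 / 8 - e ^ 3 * R1 / 2)"
    unfolding Ev2 unfolding Ev R1_def R2_def by (simp add: power2_eq_square power3_eq_cube power4_eq_xxxx field_simps)
  have main: "\<bar>ln (expectation (\<lambda>z. exp (v z))) - expectation v
    - (expectation (\<lambda>z. (v z)\<^sup>2) - (expectation v)\<^sup>2) / 2\<bar> \<le> 10 * (e * T) ^ 3"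
    using vT by (intro ln_mgf_expansion) auto
  have "(\<Sum>a\<in>A. \<Sum>c\<in>A. x a * x c *
          (expectation (\<lambda>z. \<phi> a z * \<phi> c z) - expectation (\<phi> a) * expectation (\<phi> c)))
      = expectation (\<lambda>z. X z * X z) - expectation X * expectation X"
    unfolding EX2 unfolding EXX by (simp add: right_diff_distrib sum_subtractf)
  then have "\<bar>ln (expectation (\<lambda>z. exp (v z)))
    - (e * (\<Sum>a\<in>A. x a * expectation (\<phi> a)) - e\<^sup>2 / 2 * (\<Sum>a\<in>A. expectation (\<lambda>z. (\<phi> a z)\<^sup>2))
       + e\<^sup>2 / 2 * (\<Sum>a\<in>A. \<Sum>c\<in>A. x a * x c *
          (expectation (\<lambda>z. \<phi> a z * \<phi> c z) - expectation (\<phi> a) * expectation (\<phi> c))))\<bar>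
    \<le> 12 * e ^ 3 * T ^ 3"
    using main[unfolded var] rem
    unfolding Ev EX[symmetric] EQ[symmetric] power_mult_distrib by (simp only: mult.assoc)
  then show "\<bar>ln (expectation (\<lambda>z. exp (e * (\<Sum>a\<in>A. x a * \<phi> a z) - e\<^sup>2 / 2 * (\<Sum>a\<in>A. (\<phi> a z)\<^sup>2))))
    - (e * (\<Sum>a\<in>A. x a * expectation (\<phi> a)) - e\<^sup>2 / 2 * (\<Sum>a\<in>A. expectation (\<lambda>z. (\<phi> a z)\<^sup>2))
       + e\<^sup>2 / 2 * (\<Sum>a\<in>A. \<Sum>c\<in>A. x a * x c *
          (expectation (\<lambda>z. \<phi> a z * \<phi> c z) - expectation (\<phi> a) * expectation (\<phi> c))))\<bar>
    \<le> 12 * e ^ 3 * T ^ 3"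
    by (simp add: v_def X_def Q_def)
qed

section \<open>Gaussian comparison\<close>

text \<open>A power of a nonnegative number is at most \<open>k!\<close> times its exponential,
  being one term of the exponential series; the exponential moment does the rest.\<close>

lemma integrable_gaussV_power:
  assumes "finite I" "b \<ge> 0"
  shows "integrable (gaussV I) (\<lambda>x. (c + b * (\<Sum>a\<in>I. \<bar>x a\<bar>)) ^ k)"
proof -
  have "integrable (gaussV I) (\<lambda>x. fact k * exp \<bar>c\<bar> * exp (b * (\<Sum>a\<in>I. \<bar>x a\<bar>)))"
    using integrable_gaussV_exp_abs[OF assms(1)] by simp
  then show ?thesis
  proof (rule Bochner_Integration.integrable_bound)
    have "norm ((c + b * (\<Sum>a\<in>I. \<bar>x a\<bar>)) ^ k) \<le> fact k * exp \<bar>c\<bar> * exp (b * (\<Sum>a\<in>I. \<bar>x a\<bar>))" for x :: "'a \<Rightarrow> real"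
    proof -
      define s where "s = b * (\<Sum>a\<in>I. \<bar>x a\<bar>)"
      have s0: "s \<ge> 0" unfolding s_def using assms by (simp add: sum_nonneg)
      have "norm ((c + s) ^ k) \<le> (\<bar>c\<bar> + s) ^ k"
        using s0 by (simp add: power_abs power_mono)
      also have "\<dots> \<le> fact k * exp (\<bar>c\<bar> + s)"
      proof -
        have "(\<bar>c\<bar> + s) ^ k / fact k \<le> exp (\<bar>c\<bar> + s)"
          using sum_le_suminf[OF summable_exp_generic, of "{k}" "\<bar>c\<bar> + s"] s0
          by (simp add: exp_def divide_inverse mult.commute)
        then show ?thesis by (simp add: field_simps)
      qed
      finally show ?thesis by (simp add: exp_add s_def)
    qed
    then show "AE x in gaussV I. norm ((c + b * (\<Sum>a\<in>I. \<bar>x a\<bar>)) ^ k) \<le> norm (fact k * exp \<bar>c\<bar> * exp (b * (\<Sum>a\<in>I. \<bar>x a\<bar>)))"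
      by (intro AE_I2) simp
  qed measurable
qed

lemma measure_gaussV_space [simp]: "measure (gaussV I) (space (gaussV I)) = 1"
  by (rule prob_space.prob_space) (rule prob_space_gaussV)

text \<open>Under the Gaussian average the linear term vanishes and \<open>x a * x c\<close> becomes
  the Kronecker delta. The variance term then contributes \<open>e^2/2\<close> times the mean square
  of \<open>\<phi> a\<close> minus its squared mean; the mean squares cancel the counterterm.
  \<open>T\<close> ranges over all of \<open>I\<close>, so that the error is the same for every
  \<open>A\<close>.\<close>

lemma (in prob_space) gaussian_step:
  fixes \<phi> :: "'i \<Rightarrow> 'a \<Rightarrow> real"
  assumes fin: "finite I" and AI: "A \<subseteq> I"
    and [measurable]: "\<And>a. a \<in> A \<Longrightarrow> \<phi> a \<in> borel_measurable M"
    and b: "\<And>a z. a \<in> A \<Longrightarrow> z \<in> space M \<Longrightarrow> \<bar>\<phi> a z\<bar> \<le> b"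
    and b0: "b \<ge> 0" and e: "0 \<le> e" "e \<le> 1"
  defines "T \<equiv> \<lambda>x. 1 + real (card I) * b\<^sup>2 + b * (\<Sum>a\<in>I. \<bar>x a\<bar>)"
  defines "f \<equiv> \<lambda>x. ln (expectation (\<lambda>z. exp (e * (\<Sum>a\<in>A. x a * \<phi> a z) - e\<^sup>2 / 2 * (\<Sum>a\<in>A. (\<phi> a z)\<^sup>2))))"
  shows "integrable (gaussV I) f"
    and "\<bar>(\<integral>x. f x \<partial>gaussV I) + e\<^sup>2 / 2 * (\<Sum>a\<in>A. (expectation (\<phi> a))\<^sup>2)\<bar>
      \<le> 12 * e ^ 3 * (\<integral>x. T x ^ 3 \<partial>gaussV I)"
proof -
  define g where "g x = e * (\<Sum>a\<in>A. x a * expectation (\<phi> a)) - e\<^sup>2 / 2 * (\<Sum>a\<in>A. expectation (\<lambda>z. (\<phi> a z)\<^sup>2))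
       + e\<^sup>2 / 2 * (\<Sum>a\<in>A. \<Sum>c\<in>A. x a * x c *
          (expectation (\<lambda>z. \<phi> a z * \<phi> c z) - expectation (\<phi> a) * expectation (\<phi> c)))" for x
  have finA: "finite A" using fin AI by (rule finite_subset[rotated])
  have T: "1 + b * (\<Sum>a\<in>A. \<bar>x a\<bar>) + real (card A) * b\<^sup>2 \<le> T x" for x
    using mult_left_mono[OF sum_mono2[OF fin AI, of "\<lambda>a. \<bar>x a\<bar>"] b0]
      mult_right_mono[of "real (card A)" "real (card I)" "b\<^sup>2"] card_mono[OF fin AI]
    by (simp add: T_def)
  have T1: "T x \<ge> 1" for x
    using b0 by (simp add: T_def sum_nonneg)
  have diff: "\<bar>f x - g x\<bar> \<le> 12 * e ^ 3 * T x ^ 3" for x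
    unfolding f_def g_def by (rule ln_mgf_field_expansion(1)[OF finA assms(3) b b0 e T])
  have bnd: "\<bar>e * (\<Sum>a\<in>A. x a * \<phi> a z) - e\<^sup>2 / 2 * (\<Sum>a\<in>A. (\<phi> a z)\<^sup>2)\<bar> \<le> e * T x" if "z \<in> space M" for x z
    by (rule ln_mgf_field_expansion(2)[OF finA assms(3) b b0 e T that])
  have AI': "a \<in> A \<Longrightarrow> a \<in> I" for a using AI by auto
  have [measurable]: "f \<in> borel_measurable (gaussV I)"
    unfolding f_def using AI' by measurable
  have fT: "\<bar>f x\<bar> \<le> T x" for x
  proof -
    have "\<bar>f x - ln (measure M (space M))\<bar> \<le> e * T x"
      unfolding f_def by (intro ln_integral_exp_bound(3) bnd) (simp_all add: prob_space)
    also have "\<dots> \<le> T x"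
      using e T1[of x] by (simp add: mult_left_le_one_le)
    finally show ?thesis by (simp add: prob_space)
  qed
  have iT: "integrable (gaussV I) T" "integrable (gaussV I) (\<lambda>x. T x ^ 3)"
    using integrable_gaussV_power[OF fin b0, of "1 + real (card I) * b\<^sup>2" 1]
      integrable_gaussV_power[OF fin b0, of "1 + real (card I) * b\<^sup>2" 3] by (simp_all add: T_def)
  show if': "integrable (gaussV I) f"
    by (rule Bochner_Integration.integrable_bound[OF iT(1)]) (auto intro!: AE_I2 order_trans[OF fT])
  note mom = gaussV_moments[OF fin]
  have mom1: "integrable (gaussV I) (\<lambda>x. x a)" "(\<integral>x. x a \<partial>gaussV I) = 0" if "a \<in> A" for a
    using mom(1,2)[of a a] AI'[OF that] by auto
  have mom2: "integrable (gaussV I) (\<lambda>x. x a * x c)" "(\<integral>x. x a * x c \<partial>gaussV I) = (if a = c then 1 else 0)"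
    if "a \<in> A" "c \<in> A" for a c
    using mom(3,4)[of a c] AI'[OF that(1)] AI'[OF that(2)] by auto
  note [simp] = finite_measure.integrable_const[OF prob_space.finite_measure[OF prob_space_gaussV]]
  have ig: "integrable (gaussV I) g"
    unfolding g_def using mom1 mom2 by simp
  have "(\<integral>x. g x \<partial>gaussV I) = - e\<^sup>2 / 2 * (\<Sum>a\<in>A. expectation (\<lambda>z. (\<phi> a z)\<^sup>2))
       + e\<^sup>2 / 2 * (\<Sum>a\<in>A. \<Sum>c\<in>A. (if a = c then 1 else 0) *
          (expectation (\<lambda>z. \<phi> a z * \<phi> c z) - expectation (\<phi> a) * expectation (\<phi> c)))"
    unfolding g_def using mom1 mom2
    by (simp add: Bochner_Integration.integral_sum)
  also have "\<dots> = - e\<^sup>2 / 2 * (\<Sum>a\<in>A. expectation (\<lambda>z. (\<phi> a z)\<^sup>2))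
       + e\<^sup>2 / 2 * (\<Sum>a\<in>A. expectation (\<lambda>z. (\<phi> a z)\<^sup>2) - (expectation (\<phi> a))\<^sup>2)"
  proof -
    have "(\<Sum>c\<in>A. (if a = c then 1 else 0) * h c) = h a" if "a \<in> A" for a and h :: "'i \<Rightarrow> real"
    proof -
      have "(\<Sum>c\<in>A. (if a = c then 1 else 0) * h c) = (\<Sum>c\<in>A. if a = c then h c else 0)"
        by (intro sum.cong) auto
      then show ?thesis using finA that by simp
    qed
    then show ?thesis by (simp add: power2_eq_square cong: sum.cong)
  qed
  also have "\<dots> = - (e\<^sup>2 / 2 * (\<Sum>a\<in>A. (expectation (\<phi> a))\<^sup>2))"
    by (simp add: sum_subtractf algebra_simps)
  finally have Ig: "(\<integral>x. g x \<partial>gaussV I) = \<dots>" .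
  have "\<bar>(\<integral>x. f x - g x \<partial>gaussV I)\<bar> \<le> (\<integral>x. \<bar>f x - g x\<bar> \<partial>gaussV I)"
    by (rule integral_abs_bound)
  also have "\<dots> \<le> (\<integral>x. 12 * e ^ 3 * T x ^ 3 \<partial>gaussV I)"
    using if' ig iT diff by (intro integral_mono) auto
  finally show "\<bar>(\<integral>x. f x \<partial>gaussV I) + e\<^sup>2 / 2 * (\<Sum>a\<in>A. (expectation (\<phi> a))\<^sup>2)\<bar>
      \<le> 12 * e ^ 3 * (\<integral>x. T x ^ 3 \<partial>gaussV I)"
    using if' ig Ig by simp
qed

text \<open>Writing the square of a mean as a double integral introduces two replicas
  \<open>z\<close> and \<open>w\<close>, and the sum over \<open>a\<close> becomes the covariance
  kernel. In this form a pointwise inequality between kernels can be integrated.\<close>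

lemma (in prob_space) sum_expectation_sq:
  fixes \<phi> :: "'i \<Rightarrow> 'a \<Rightarrow> real"
  assumes fin: "finite A"
    and [measurable]: "\<And>a. a \<in> A \<Longrightarrow> \<phi> a \<in> borel_measurable M"
    and b: "\<And>a z. a \<in> A \<Longrightarrow> z \<in> space M \<Longrightarrow> \<bar>\<phi> a z\<bar> \<le> b"
  shows "(\<Sum>a\<in>A. (expectation (\<phi> a))\<^sup>2) = expectation (\<lambda>z. expectation (\<lambda>w. \<Sum>a\<in>A. \<phi> a z * \<phi> a w))"
    and "z \<in> space M \<Longrightarrow> integrable M (\<lambda>w. \<Sum>a\<in>A. \<phi> a z * \<phi> a w)"
    and "integrable M (\<lambda>z. expectation (\<lambda>w. \<Sum>a\<in>A. \<phi> a z * \<phi> a w))"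
proof -
  have i: "integrable M (\<phi> a)" if "a \<in> A" for a
    using b that by (intro abs_expectation_le(1)[of _ b]) auto
  have E: "expectation (\<lambda>w. \<Sum>a\<in>A. \<phi> a z * \<phi> a w) = (\<Sum>a\<in>A. \<phi> a z * expectation (\<phi> a))" for z
    using i by (simp add: Bochner_Integration.integral_sum)
  show "(\<Sum>a\<in>A. (expectation (\<phi> a))\<^sup>2) = expectation (\<lambda>z. expectation (\<lambda>w. \<Sum>a\<in>A. \<phi> a z * \<phi> a w))"
    unfolding E using i by (simp add: Bochner_Integration.integral_sum power2_eq_square)
  show "integrable M (\<lambda>w. \<Sum>a\<in>A. \<phi> a z * \<phi> a w)"
    using i by simp
  show "integrable M (\<lambda>z. expectation (\<lambda>w. \<Sum>a\<in>A. \<phi> a z * \<phi> a w))"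
    unfolding E using i by simp
qed

lemma (in finite_measure) gaussian_step_comparison:
  fixes \<phi> :: "'i \<Rightarrow> 'a \<Rightarrow> real"
  assumes fin: "finite I" and AI: "A \<subseteq> I" and BI: "B \<subseteq> I"
    and m\<phi>[measurable]: "\<And>a. a \<in> I \<Longrightarrow> \<phi> a \<in> borel_measurable M"
    and b: "\<And>a z. a \<in> I \<Longrightarrow> z \<in> space M \<Longrightarrow> \<bar>\<phi> a z\<bar> \<le> b"
    and b0: "b \<ge> 0" and e: "0 \<le> e" "e \<le> 1"
    and mV[measurable]: "V \<in> borel_measurable M" and V: "\<And>z. z \<in> space M \<Longrightarrow> \<bar>V z\<bar> \<le> m"
    and pos: "0 < measure M (space M)"
    and ker: "\<And>z w. z \<in> space M \<Longrightarrow> w \<in> space M \<Longrightarrow>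
      (\<Sum>a\<in>A. \<phi> a z * \<phi> a w) \<le> (\<Sum>a\<in>B. \<phi> a z * \<phi> a w) + D"
  defines "T \<equiv> \<lambda>x. 1 + real (card I) * b\<^sup>2 + b * (\<Sum>a\<in>I. \<bar>x a\<bar>)"
  defines "f \<equiv> \<lambda>A x. ln (\<integral>z. exp (V z + (e * (\<Sum>a\<in>A. x a * \<phi> a z) - e\<^sup>2 / 2 * (\<Sum>a\<in>A. (\<phi> a z)\<^sup>2))) \<partial>M)"
  shows "(\<integral>x. f B x \<partial>gaussV I) - (e\<^sup>2 / 2 * D + 24 * e ^ 3 * (\<integral>x. T x ^ 3 \<partial>gaussV I))
    \<le> (\<integral>x. f A x \<partial>gaussV I)"
proof -
  define Z where "Z = (\<integral>z. exp (V z) \<partial>M)"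
  have iV: "integrable M (\<lambda>z. exp (V z))" and Z: "Z > 0"
    using ln_integral_exp_bound(1,2)[OF mV V pos] by (auto simp: Z_def)
  \<comment> \<open>the Gibbs measure, under which one portion of the field is expanded\<close>
  define P where "P = density M (\<lambda>z. ennreal (exp (V z) / Z))"
  have sets [measurable_cong]: "sets P = sets M" and sp: "space P = space M"
    by (simp_all add: P_def)
  interpret P: prob_space P
  proof
    have "emeasure P (space P) = (\<integral>\<^sup>+z. ennreal (exp (V z) / Z) \<partial>M)"
      unfolding P_def by (simp add: emeasure_density cong: nn_integral_cong)
    also have "\<dots> = ennreal (\<integral>z. exp (V z) / Z \<partial>M)"
      using iV Z by (intro nn_integral_eq_integral) auto
    also have "\<dots> = 1"
      using Z by (simp add: Z_def[symmetric])
    finally show "emeasure P (space P) = 1" .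
  qed
  have intP: "(\<integral>z. g z \<partial>P) = (\<integral>z. exp (V z) * g z \<partial>M) / Z" if [measurable]: "g \<in> borel_measurable M" for g :: "'a \<Rightarrow> real"
    unfolding P_def using Z by (subst integral_density) auto
  define u where "u A x z = e * (\<Sum>a\<in>A. x a * \<phi> a z) - e\<^sup>2 / 2 * (\<Sum>a\<in>A. (\<phi> a z)\<^sup>2)" for A and x :: "'i \<Rightarrow> real" and z
  have key: "(\<integral>x. f C x \<partial>gaussV I) = ln Z + (\<integral>x. ln (\<integral>z. exp (u C x z) \<partial>P) \<partial>gaussV I)"
    "\<bar>(\<integral>x. ln (\<integral>z. exp (u C x z) \<partial>P) \<partial>gaussV I) + e\<^sup>2 / 2 * (\<Sum>a\<in>C. (\<integral>z. \<phi> a z \<partial>P)\<^sup>2)\<bar> \<le>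
       12 * e ^ 3 * (\<integral>x. T x ^ 3 \<partial>gaussV I)" if CI: "C \<subseteq> I" for C
  proof -
    have mC: "\<phi> a \<in> borel_measurable P" if "a \<in> C" for a
      using m\<phi> that CI by auto
    have bC: "\<bar>\<phi> a z\<bar> \<le> b" if "a \<in> C" "z \<in> space P" for a z
      using b that CI by (auto simp: sp)
    note st = P.gaussian_step[where I = I and A = C and \<phi> = \<phi> and b = b and e = e, OF fin CI mC bC b0 e]
    have mu: "u C x \<in> borel_measurable M" for x
      unfolding u_def using CI by (intro borel_measurable_diff borel_measurable_times borel_measurable_const
          borel_measurable_sum borel_measurable_power m\<phi>) auto
    have "f C x = ln Z + ln (\<integral>z. exp (u C x z) \<partial>P)" for x
    proof -
      have "finite C" using CI fin by (rule finite_subset)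
      have "0 < (\<integral>z. exp (u C x z) \<partial>P)"
      proof (rule P.ln_integral_exp_bound(2))
        show "u C x \<in> borel_measurable P" using mu by simp
        show "\<bar>u C x z\<bar> \<le> e * (1 + b * (\<Sum>a\<in>C. \<bar>x a\<bar>) + real (card C) * b\<^sup>2)" if "z \<in> space P" for z
          unfolding u_def
          by (rule P.ln_mgf_field_expansion(2)[OF \<open>finite C\<close> mC bC b0 e order_refl that])
      qed (simp add: P.prob_space)
      then have "ln Z + ln (\<integral>z. exp (u C x z) \<partial>P) = ln (Z * (\<integral>z. exp (u C x z) \<partial>P))"
        using Z by (simp add: ln_mult)
      also have "Z * (\<integral>z. exp (u C x z) \<partial>P) = (\<integral>z. exp (V z) * exp (u C x z) \<partial>M)"
        using Z mu by (subst intP) auto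
      finally show ?thesis by (simp add: f_def exp_add u_def)
    qed
    then show "(\<integral>x. f C x \<partial>gaussV I) = ln Z + (\<integral>x. ln (\<integral>z. exp (u C x z) \<partial>P) \<partial>gaussV I)"
      using st(1)[folded u_def] finite_measure.integrable_const[OF prob_space.finite_measure[OF prob_space_gaussV]]
      by simp
    show "\<bar>(\<integral>x. ln (\<integral>z. exp (u C x z) \<partial>P) \<partial>gaussV I) + e\<^sup>2 / 2 * (\<Sum>a\<in>C. (\<integral>z. \<phi> a z \<partial>P)\<^sup>2)\<bar> \<le>
       12 * e ^ 3 * (\<integral>x. T x ^ 3 \<partial>gaussV I)"
      using st(2) by (simp only: T_def u_def)
  qed
  have "(\<Sum>a\<in>A. (\<integral>z. \<phi> a z \<partial>P)\<^sup>2) \<le> (\<Sum>a\<in>B. (\<integral>z. \<phi> a z \<partial>P)\<^sup>2) + D"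
  proof -
    have mP: "\<phi> a \<in> borel_measurable P" if "a \<in> I" for a using m\<phi>[OF that] by simp
    have E: "(\<Sum>a\<in>X. (\<integral>z. \<phi> a z \<partial>P)\<^sup>2) = (\<integral>z. (\<integral>w. (\<Sum>a\<in>X. \<phi> a z * \<phi> a w) \<partial>P) \<partial>P)"
      and E': "\<And>z. z \<in> space P \<Longrightarrow> integrable P (\<lambda>w. \<Sum>a\<in>X. \<phi> a z * \<phi> a w)"
      and E'': "integrable P (\<lambda>z. \<integral>w. (\<Sum>a\<in>X. \<phi> a z * \<phi> a w) \<partial>P)" if XI: "X \<subseteq> I" for X
    proof -
      have X: "finite X" "\<And>a. a \<in> X \<Longrightarrow> \<phi> a \<in> borel_measurable P"
        "\<And>a z. a \<in> X \<Longrightarrow> z \<in> space P \<Longrightarrow> \<bar>\<phi> a z\<bar> \<le> b"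
        using XI fin finite_subset mP b by (auto simp: sp)
      show "(\<Sum>a\<in>X. (\<integral>z. \<phi> a z \<partial>P)\<^sup>2) = (\<integral>z. (\<integral>w. (\<Sum>a\<in>X. \<phi> a z * \<phi> a w) \<partial>P) \<partial>P)"
        by (rule P.sum_expectation_sq(1)[OF X])
      show "integrable P (\<lambda>w. \<Sum>a\<in>X. \<phi> a z * \<phi> a w)" if "z \<in> space P" for z
        by (rule P.sum_expectation_sq(2)[OF X that])
      show "integrable P (\<lambda>z. \<integral>w. (\<Sum>a\<in>X. \<phi> a z * \<phi> a w) \<partial>P)"
        by (rule P.sum_expectation_sq(3)[OF X])
    qed
    note sA = E[OF AI] E'[OF AI] E''[OF AI] and sB = E[OF BI] E'[OF BI] E''[OF BI]
    have "(\<Sum>a\<in>A. (\<integral>z. \<phi> a z \<partial>P)\<^sup>2) = (\<integral>z. (\<integral>w. (\<Sum>a\<in>A. \<phi> a z * \<phi> a w) \<partial>P) \<partial>P)"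
      by (rule sA(1))
    also have "\<dots> \<le> (\<integral>z. (\<integral>w. (\<Sum>a\<in>B. \<phi> a z * \<phi> a w) \<partial>P) + D \<partial>P)"
    proof (rule integral_mono)
      fix z assume z: "z \<in> space P"
      have "(\<integral>w. (\<Sum>a\<in>A. \<phi> a z * \<phi> a w) \<partial>P) \<le> (\<integral>w. (\<Sum>a\<in>B. \<phi> a z * \<phi> a w) + D \<partial>P)"
        using sA(2)[OF z] sB(2)[OF z] ker z by (intro integral_mono) (auto simp: sp)
      also have "\<dots> = (\<integral>w. (\<Sum>a\<in>B. \<phi> a z * \<phi> a w) \<partial>P) + D"
        using sB(2)[OF z] by (simp add: P.prob_space)
      finally show "(\<integral>w. (\<Sum>a\<in>A. \<phi> a z * \<phi> a w) \<partial>P) \<le> (\<integral>w. (\<Sum>a\<in>B. \<phi> a z * \<phi> a w) \<partial>P) + D" .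
    qed (use sA(3) sB(3) in auto)
    also have "\<dots> = (\<Sum>a\<in>B. (\<integral>z. \<phi> a z \<partial>P)\<^sup>2) + D"
      using sB(1,3) by (simp add: P.prob_space)
    finally show ?thesis .
  qed
  then have "e\<^sup>2 / 2 * (\<Sum>a\<in>A. (\<integral>z. \<phi> a z \<partial>P)\<^sup>2) \<le> e\<^sup>2 / 2 * ((\<Sum>a\<in>B. (\<integral>z. \<phi> a z \<partial>P)\<^sup>2) + D)"
    by (intro mult_left_mono) auto
  then show ?thesis
    using key[OF AI] key[OF BI] by (simp only: distrib_left)
qed

text \<open>Both fields live on one Gaussian vector: the disjoint index sets \<open>A\<close> and
  \<open>B\<close> make them independent, and variance moves between them inside
  \<open>gaussV I\<close>. Disjointness also keeps the variance of each coordinate at most 1 along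
  the path.\<close>

lemma (in finite_measure) gaussian_comparison:
  fixes \<phi> :: "'i \<Rightarrow> 'a \<Rightarrow> real"
  assumes fin: "finite I" and AI: "A \<subseteq> I" and BI: "B \<subseteq> I" and AB: "A \<inter> B = {}"
    and m\<phi>[measurable]: "\<And>a. a \<in> I \<Longrightarrow> \<phi> a \<in> borel_measurable M"
    and b: "\<And>a z. a \<in> I \<Longrightarrow> z \<in> space M \<Longrightarrow> \<bar>\<phi> a z\<bar> \<le> b"
    and mW[measurable]: "W \<in> borel_measurable M" and W: "\<And>z. z \<in> space M \<Longrightarrow> \<bar>W z\<bar> \<le> c"
    and pos: "0 < measure M (space M)"
    and ker: "\<And>z w. z \<in> space M \<Longrightarrow> w \<in> space M \<Longrightarrow>
      (\<Sum>a\<in>A. \<phi> a z * \<phi> a w) \<le> (\<Sum>a\<in>B. \<phi> a z * \<phi> a w) + D"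
  defines "f \<equiv> \<lambda>A x. ln (\<integral>z. exp (W z + (\<Sum>a\<in>A. x a * \<phi> a z) - (\<Sum>a\<in>A. (\<phi> a z)\<^sup>2) / 2) \<partial>M)"
  shows "(\<integral>x. f B x \<partial>gaussV I) - D / 2 \<le> (\<integral>x. f A x \<partial>gaussV I)"
    and "integrable (gaussV I) (f A)" "integrable (gaussV I) (f B)"
proof -
  \<comment> \<open>The bound on \<open>\<phi>\<close> does not control the sign of \<open>b\<close>
    when \<open>I\<close> is empty, while the step lemmas require a nonnegative bound.\<close>
  define b' where "b' = max b 0"
  have b': "b' \<ge> 0" "\<And>a z. a \<in> I \<Longrightarrow> z \<in> space M \<Longrightarrow> \<bar>\<phi> a z\<bar> \<le> b'"
    using b by (auto simp: b'_def intro: max.coboundedI1)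
  \<comment> \<open>The variance profile \<open>q\<close> weights the coordinates; the path runs from the indicator of \<open>B\<close> to that of \<open>A\<close>.\<close>
  define ham where "ham q x z = W z + (\<Sum>a\<in>I. x a * \<phi> a z) - (\<Sum>a\<in>I. q a * (\<phi> a z)\<^sup>2) / 2"
    for q x :: "'i \<Rightarrow> real" and z
  define L where "L q x = ln (\<integral>z. exp (ham q x z) \<partial>M)" for q x
  \<comment> \<open>\<open>ham q\<close> weights only the counterterm; the field receives its
    variance \<open>q a\<close> here, through the factor \<open>sqrt (q a)\<close>. Field and
    counterterm thus match all along the path.\<close>
  define F where "F q = (\<integral>x. L q (\<lambda>a. sqrt (q a) * x a) \<partial>gaussV I)" for q
  \<comment> \<open>The error constant of \<open>gaussian_step_comparison\<close>; it is free of
    \<open>q\<close> and \<open>e\<close>, hence common to all trades.\<close>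
  define K where "K = (\<integral>x. (1 + real (card I) * b'\<^sup>2 + b' * (\<Sum>a\<in>I. \<bar>x a\<bar>)) ^ 3 \<partial>gaussV I)"
  define Q where "Q = c + real (card I) * b'\<^sup>2"
  define C where "C = Q + \<bar>ln (measure M (space M))\<bar>"
  have mham: "(\<lambda>p. ham q (fst p) (snd p)) \<in> borel_measurable (gaussV I \<Otimes>\<^sub>M M)" for q
    unfolding ham_def by measurable
  have mhamz[measurable]: "ham q x \<in> borel_measurable M" for q x
    unfolding ham_def by measurable
  have mL [measurable]: "L q \<in> borel_measurable (gaussV I)" for q
    unfolding L_def using mham by (intro borel_measurable_ln borel_measurable_lebesgue_integral)
      (simp add: case_prod_beta)
  have hamb: "\<bar>ham q x z\<bar> \<le> Q + b' * (\<Sum>a\<in>I. \<bar>x a\<bar>)"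
    if z: "z \<in> space M" and q: "\<And>a. a \<in> I \<Longrightarrow> 0 \<le> q a \<and> q a \<le> 1" for q x z
  proof -
    have "\<bar>\<Sum>a\<in>I. x a * \<phi> a z\<bar> \<le> (\<Sum>a\<in>I. \<bar>x a * \<phi> a z\<bar>)"
      by (rule sum_abs)
    also have "\<dots> \<le> (\<Sum>a\<in>I. b' * \<bar>x a\<bar>)"
      using b'(2)[OF _ z] by (intro sum_mono) (simp add: abs_mult mult.commute[of b'] mult_left_mono)
    finally have 1: "\<bar>\<Sum>a\<in>I. x a * \<phi> a z\<bar> \<le> b' * (\<Sum>a\<in>I. \<bar>x a\<bar>)"
      by (simp add: sum_distrib_left)
    have 2: "(\<Sum>a\<in>I. q a * (\<phi> a z)\<^sup>2) \<le> real (card I) * b'\<^sup>2"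
    proof (rule sum_bounded_above)
      fix a assume a: "a \<in> I"
      have "(\<phi> a z)\<^sup>2 \<le> b'\<^sup>2"
        using power_mono[OF b'(2)[OF a z], of 2] by simp
      then have "q a * (\<phi> a z)\<^sup>2 \<le> 1 * b'\<^sup>2"
        using q[OF a] by (intro mult_mono) auto
      then show "q a * (\<phi> a z)\<^sup>2 \<le> b'\<^sup>2" by simp
    qed
    have 3: "0 \<le> (\<Sum>a\<in>I. q a * (\<phi> a z)\<^sup>2)"
      using q by (intro sum_nonneg) auto
    show ?thesis
      using 1 2 3 W[OF z] unfolding ham_def Q_def by linarith
  qed
  have Lb: "\<bar>L q x\<bar> \<le> C + b' * (\<Sum>a\<in>I. \<bar>x a\<bar>)"
    if q: "\<And>a. a \<in> I \<Longrightarrow> 0 \<le> q a \<and> q a \<le> 1" for q x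
  proof -
    have "\<bar>L q x - ln (measure M (space M))\<bar> \<le> Q + b' * (\<Sum>a\<in>I. \<bar>x a\<bar>)"
      unfolding L_def by (intro ln_integral_exp_bound(3) hamb that pos) auto
    then show ?thesis unfolding C_def by linarith
  qed
  have iS: "integrable (gaussV I) (\<lambda>x. C + b' * (\<Sum>a\<in>I. \<bar>x a\<bar>))"
    using integrable_gaussV_power[OF fin b'(1), of C 1] by simp
  have restr: "L q (\<lambda>a\<in>I. x a) = L q x" for q x
    by (simp add: L_def ham_def cong: sum.cong)
  \<comment> \<open>Raising the variance on \<open>S\<close> by \<open>e^2\<close> amounts in law to
    adding an independent layer \<open>y\<close> of size \<open>e\<close>. Fubini puts the integral
    over \<open>y\<close> inside, where the layer \<open>x\<close> is constant.\<close>
  have split: "F (\<lambda>a. q a + e\<^sup>2 * indicator S a) =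
      (\<integral>x. \<integral>y. ln (\<integral>z. exp (ham q (\<lambda>a. sqrt (q a) * x a) z +
        (e * (\<Sum>a\<in>S. y a * \<phi> a z) - e\<^sup>2 / 2 * (\<Sum>a\<in>S. (\<phi> a z)\<^sup>2))) \<partial>M) \<partial>gaussV I \<partial>gaussV I)"
    and split_int: "integrable (gaussV I) (\<lambda>x. \<integral>y. ln (\<integral>z. exp (ham q (\<lambda>a. sqrt (q a) * x a) z +
        (e * (\<Sum>a\<in>S. y a * \<phi> a z) - e\<^sup>2 / 2 * (\<Sum>a\<in>S. (\<phi> a z)\<^sup>2))) \<partial>M) \<partial>gaussV I)"
    and F_int: "integrable (gaussV I) (\<lambda>x. L (\<lambda>a. q a + e\<^sup>2 * indicator S a) (\<lambda>a. sqrt (q a + e\<^sup>2 * indicator S a) * x a))"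
    if SI: "S \<subseteq> I" and e: "0 \<le> e"
      and q: "\<And>a. a \<in> I \<Longrightarrow> 0 \<le> q a \<and> q a + e\<^sup>2 * indicator S a \<le> 1" for q S e
  proof -
    interpret GG: pair_prob_space "gaussV I" "gaussV I"
      by (simp add: pair_prob_space_def pair_sigma_finite_def prob_space_gaussV prob_space_imp_sigma_finite)
    define q' where "q' a = q a + e\<^sup>2 * indicator S a" for a
    define g where "g p = (\<lambda>a\<in>I. sqrt (q a) * fst p a + (e * indicator S a) * snd p a)"
      for p :: "('i \<Rightarrow> real) \<times> ('i \<Rightarrow> real)"
    have q': "0 \<le> q' a \<and> q' a \<le> 1" if "a \<in> I" for a
      using q[OF that] by (simp add: q'_def)
    have mg [measurable]: "g \<in> gaussV I \<Otimes>\<^sub>M gaussV I \<rightarrow>\<^sub>M gaussV I"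
      unfolding g_def by (rule measurable_restrict) measurable
    have mh [measurable]: "(\<lambda>x. \<lambda>a\<in>I. sqrt (q' a) * x a) \<in> gaussV I \<rightarrow>\<^sub>M gaussV I"
      by (rule measurable_restrict) measurable
    have dist: "distr (gaussV I \<Otimes>\<^sub>M gaussV I) (gaussV I) g = distr (gaussV I) (gaussV I) (\<lambda>x. \<lambda>a\<in>I. sqrt (q' a) * x a)"
    proof -
      have g: "g = (\<lambda>(x, y). \<lambda>a\<in>I. sqrt (q a) * x a + (e * indicator S a) * y a)"
        by (auto simp: fun_eq_iff g_def)
      have "distr (gaussV I \<Otimes>\<^sub>M gaussV I) (gaussV I) g =
        distr (gaussV I) (gaussV I) (\<lambda>x. \<lambda>a\<in>I. sqrt ((sqrt (q a))\<^sup>2 + (e * indicator S a)\<^sup>2) * x a)"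
        unfolding g by (rule gaussV_add[OF fin])
      also have "(\<lambda>x. \<lambda>a\<in>I. sqrt ((sqrt (q a))\<^sup>2 + (e * indicator S a)\<^sup>2) * x a) = (\<lambda>x. \<lambda>a\<in>I. sqrt (q' a) * x a)"
        using q by (auto simp: fun_eq_iff restrict_def q'_def power_mult_distrib indicator_def)
      finally show ?thesis .
    qed
    have iR: "integrable (gaussV I) (\<lambda>x. L q' (\<lambda>a\<in>I. sqrt (q' a) * x a))"
    proof (rule Bochner_Integration.integrable_bound[OF iS])
      have "\<bar>L q' (\<lambda>a\<in>I. sqrt (q' a) * x a)\<bar> \<le> C + b' * (\<Sum>a\<in>I. \<bar>x a\<bar>)" for x
      proof -
        have "\<bar>L q' (\<lambda>a\<in>I. sqrt (q' a) * x a)\<bar> \<le> C + b' * (\<Sum>a\<in>I. \<bar>sqrt (q' a) * x a\<bar>)"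
          unfolding restr using q' by (rule Lb)
        also have "\<dots> \<le> C + b' * (\<Sum>a\<in>I. \<bar>x a\<bar>)"
          using q' b'(1) by (intro add_left_mono mult_left_mono sum_mono)
            (auto simp: abs_mult intro!: mult_left_le_one_le)
        finally show ?thesis .
      qed
      then show "AE x in gaussV I. norm (L q' (\<lambda>a\<in>I. sqrt (q' a) * x a)) \<le> norm (C + b' * (\<Sum>a\<in>I. \<bar>x a\<bar>))"
        by (intro AE_I2) (auto intro: order_trans[OF _ abs_ge_self])
    qed measurable
    then show "integrable (gaussV I) (\<lambda>x. L (\<lambda>a. q a + e\<^sup>2 * indicator S a) (\<lambda>a. sqrt (q a + e\<^sup>2 * indicator S a) * x a))"
      unfolding restr q'_def .
    have "integrable (distr (gaussV I) (gaussV I) (\<lambda>x. \<lambda>a\<in>I. sqrt (q' a) * x a)) (L q')"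
      using iR by (subst integrable_distr_eq) auto
    then have iG: "integrable (gaussV I \<Otimes>\<^sub>M gaussV I) (\<lambda>p. L q' (g p))"
      unfolding dist[symmetric] by (subst (asm) integrable_distr_eq) auto
    have Lg: "L q' (g (x, y)) = ln (\<integral>z. exp (ham q (\<lambda>a. sqrt (q a) * x a) z +
        (e * (\<Sum>a\<in>S. y a * \<phi> a z) - e\<^sup>2 / 2 * (\<Sum>a\<in>S. (\<phi> a z)\<^sup>2))) \<partial>M)" for x y
    proof -
      have "ham q' (g (x, y)) z = ham q (\<lambda>a. sqrt (q a) * x a) z +
        (e * (\<Sum>a\<in>S. y a * \<phi> a z) - e\<^sup>2 / 2 * (\<Sum>a\<in>S. (\<phi> a z)\<^sup>2))" for z
      proof -
        have *: "(\<Sum>a\<in>I. indicator S a * h a) = (\<Sum>a\<in>S. h a)" for h :: "'i \<Rightarrow> real"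
          using SI fin by (simp add: sum.inter_restrict[symmetric] indicator_def if_distrib[of "\<lambda>u. u * _"]
              Int_absorb1 cong: if_cong flip: sum.inter_restrict)
        have "(\<Sum>a\<in>I. g (x, y) a * \<phi> a z) = (\<Sum>a\<in>I. sqrt (q a) * x a * \<phi> a z) + (\<Sum>a\<in>I. indicator S a * (e * (y a * \<phi> a z)))"
          unfolding sum.distrib[symmetric] by (intro sum.cong) (auto simp: g_def algebra_simps)
        moreover have "(\<Sum>a\<in>I. q' a * (\<phi> a z)\<^sup>2) = (\<Sum>a\<in>I. q a * (\<phi> a z)\<^sup>2) + (\<Sum>a\<in>I. indicator S a * (e\<^sup>2 * (\<phi> a z)\<^sup>2))"
          unfolding sum.distrib[symmetric] by (intro sum.cong) (auto simp: q'_def algebra_simps)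
        ultimately show ?thesis
          unfolding ham_def * by (simp add: sum_distrib_left[symmetric] add_divide_distrib)
      qed
      then show ?thesis by (simp add: L_def)
    qed
    have "F q' = (\<integral>x. L q' (\<lambda>a\<in>I. sqrt (q' a) * x a) \<partial>gaussV I)"
      unfolding F_def restr ..
    also have "\<dots> = (\<integral>x. L q' x \<partial>distr (gaussV I) (gaussV I) (\<lambda>x. \<lambda>a\<in>I. sqrt (q' a) * x a))"
      by (simp add: integral_distr)
    also have "\<dots> = (\<integral>p. L q' (g p) \<partial>(gaussV I \<Otimes>\<^sub>M gaussV I))"
      unfolding dist[symmetric] by (simp add: integral_distr)
    also have "\<dots> = (\<integral>x. \<integral>y. L q' (g (x, y)) \<partial>gaussV I \<partial>gaussV I)"
      by (rule GG.integral_fst'[symmetric, OF iG])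
    finally show "F (\<lambda>a. q a + e\<^sup>2 * indicator S a) =
      (\<integral>x. \<integral>y. ln (\<integral>z. exp (ham q (\<lambda>a. sqrt (q a) * x a) z +
        (e * (\<Sum>a\<in>S. y a * \<phi> a z) - e\<^sup>2 / 2 * (\<Sum>a\<in>S. (\<phi> a z)\<^sup>2))) \<partial>M) \<partial>gaussV I \<partial>gaussV I)"
      unfolding Lg q'_def .
    show "integrable (gaussV I) (\<lambda>x. \<integral>y. ln (\<integral>z. exp (ham q (\<lambda>a. sqrt (q a) * x a) z +
        (e * (\<Sum>a\<in>S. y a * \<phi> a z) - e\<^sup>2 / 2 * (\<Sum>a\<in>S. (\<phi> a z)\<^sup>2))) \<partial>M) \<partial>gaussV I)"
      using GG.integrable_fst'[OF iG] unfolding Lg .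
  qed
  \<comment> \<open>For each frozen \<open>x\<close>, the portion on \<open>B\<close> and the
    portion on \<open>A\<close> sit on the same base \<open>q\<close>. The error of the comparison
    is independent of \<open>x\<close> and survives integration over \<open>x\<close>.\<close>
  have step: "F (\<lambda>a. q a + e\<^sup>2 * indicator B a) - (e\<^sup>2 / 2 * D + 24 * e ^ 3 * K) \<le> F (\<lambda>a. q a + e\<^sup>2 * indicator A a)"
    if e: "0 \<le> e" "e \<le> 1"
      and q: "\<And>a. a \<in> I \<Longrightarrow> 0 \<le> q a" "\<And>a. a \<in> I \<Longrightarrow> q a + e\<^sup>2 * indicator A a \<le> 1"
        "\<And>a. a \<in> I \<Longrightarrow> q a + e\<^sup>2 * indicator B a \<le> 1" for q e
  proof -
    define h where "h S x = (\<integral>y. ln (\<integral>z. exp (ham q (\<lambda>a. sqrt (q a) * x a) z +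
        (e * (\<Sum>a\<in>S. y a * \<phi> a z) - e\<^sup>2 / 2 * (\<Sum>a\<in>S. (\<phi> a z)\<^sup>2))) \<partial>M) \<partial>gaussV I)" for S and x :: "'i \<Rightarrow> real"
    have q1: "q a \<le> 1" if "a \<in> I" for a
      using q(2)[OF that] by (rule order_trans[rotated]) simp
    have hAB: "h B x - (e\<^sup>2 / 2 * D + 24 * e ^ 3 * K) \<le> h A x" for x
      unfolding h_def K_def
      by (rule gaussian_step_comparison[OF fin AI BI m\<phi> b'(2,1) e mhamz hamb pos ker])
         (use q q1 in auto)
    have iA: "integrable (gaussV I) (h A)"
      unfolding h_def[abs_def] by (rule split_int[OF AI]) (use q e in auto)
    have iB: "integrable (gaussV I) (h B)"
      unfolding h_def[abs_def] by (rule split_int[OF BI]) (use q e in auto)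
    have "(\<integral>x. h B x - (e\<^sup>2 / 2 * D + 24 * e ^ 3 * K) \<partial>gaussV I) \<le> (\<integral>x. h A x \<partial>gaussV I)"
      using iA iB hAB by (intro integral_mono) auto
    then have "(\<integral>x. h B x \<partial>gaussV I) - (e\<^sup>2 / 2 * D + 24 * e ^ 3 * K) \<le> (\<integral>x. h A x \<partial>gaussV I)"
      using iB by simp
    moreover have "F (\<lambda>a. q a + e\<^sup>2 * indicator S a) = (\<integral>x. h S x \<partial>gaussV I)" if "S = A \<or> S = B" for S
      unfolding h_def by (rule split) (use q e that AI BI in auto)
    ultimately show ?thesis by simp
  qed
  have F_end: "F (indicator S) = (\<integral>x. f S x \<partial>gaussV I)" and f_int: "integrable (gaussV I) (f S)" if SI: "S \<subseteq> I" for S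
  proof -
    have *: "L (indicator S) (\<lambda>a. sqrt (indicator S a) * x a) = f S x" for x
    proof -
      have "(\<Sum>a\<in>I. sqrt (indicator S a) * x a * \<phi> a z) = (\<Sum>a\<in>S. x a * \<phi> a z)" for z
        by (rule sum.mono_neutral_cong_right[OF fin SI]) auto
      moreover have "(\<Sum>a\<in>I. indicator S a * (\<phi> a z)\<^sup>2) = (\<Sum>a\<in>S. (\<phi> a z)\<^sup>2)" for z
        by (rule sum.mono_neutral_cong_right[OF fin SI]) auto
      ultimately show ?thesis by (simp add: L_def ham_def f_def)
    qed
    show "F (indicator S) = (\<integral>x. f S x \<partial>gaussV I)" unfolding F_def * ..
    \<comment> \<open>Base profile 0 and \<open>e = 1\<close>: a single portion that produces unit
      variance on \<open>S\<close>.\<close>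
    show "integrable (gaussV I) (f S)"
      using F_int[OF SI, of 1 "\<lambda>_. 0"] by (simp add: * indicator_le_1)
  qed
  show "integrable (gaussV I) (f A)" "integrable (gaussV I) (f B)"
    by (rule f_int[OF AI], rule f_int[OF BI])
  have path: "F (indicator B) - D / 2 - 24 * K * inverse (sqrt (real n)) \<le> F (indicator A)" if n: "n > 0" for n
  proof -
    define e where "e = inverse (sqrt (real n))"
    have e2: "e\<^sup>2 = 1 / real n" using n by (simp add: e_def inverse_eq_divide power_divide)
    have e: "0 \<le> e" "e \<le> 1"
      using n by (simp_all add: e_def inverse_le_1_iff)
    define \<delta> where "\<delta> = e\<^sup>2 / 2 * D + 24 * e ^ 3 * K"
    define r where "r k a = real k / real n * indicator A a + (1 - real k / real n) * indicator B a" for k and a :: 'i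
    have dis: "a \<in> A \<Longrightarrow> a \<notin> B" for a using AB by auto
    have "F (r 0) - real k * \<delta> \<le> F (r k)" if "k \<le> n" for k
      using that
    proof (induction k)
      case (Suc k)
      \<comment> \<open>The common part of two consecutive profiles: adding \<open>1 / n\<close> on
        \<open>B\<close> gives \<open>r k\<close>, adding it on \<open>A\<close> gives
        \<open>r (Suc k)\<close>.\<close>
      define q where "q a = real k / real n * indicator A a + (1 - real (Suc k) / real n) * indicator B a" for a :: 'i
      have kn: "real (Suc k) / real n \<le> 1" "real k / real n + 1 / real n = real (Suc k) / real n" "0 \<le> real k / real n"
        using Suc.prems n by (auto simp: field_simps)
      have rA: "(\<lambda>a. q a + e\<^sup>2 * indicator A a) = r (Suc k)"
        using kn(2) by (auto simp: q_def r_def e2 fun_eq_iff indicator_def)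
      have rB: "(\<lambda>a. q a + e\<^sup>2 * indicator B a) = r k"
        using kn(2) by (auto simp: q_def r_def e2 fun_eq_iff indicator_def)
      have r1: "r j a \<le> 1" if "j \<le> n" for j a
        using that n dis[of a] by (auto simp: r_def indicator_def)
      have "F (r k) - \<delta> \<le> F (r (Suc k))"
        unfolding rA[symmetric] rB[symmetric] \<delta>_def
      proof (rule step[OF e])
        show "0 \<le> q a" for a
          using kn by (auto simp: q_def indicator_def)
        show "q a + e\<^sup>2 * indicator A a \<le> 1" for a
          using fun_cong[OF rA, of a] r1[of "Suc k" a] Suc.prems by simp
        show "q a + e\<^sup>2 * indicator B a \<le> 1" for a
          using fun_cong[OF rB, of a] r1[of k a] Suc.prems by simp
      qed
      then show ?case using Suc by (simp add: algebra_simps)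
    qed simp
    from this[of n] have "F (r 0) - real n * \<delta> \<le> F (r n)"
      by simp
    moreover have "r 0 = indicator B" "r n = indicator A"
      using n by (auto simp: r_def fun_eq_iff)
    \<comment> \<open>As \<open>n * e^2 = 1\<close>, the contributions of \<open>D\<close> add up to
      \<open>D / 2\<close> whatever \<open>n\<close> is, and the cubic errors retain one factor
      \<open>e\<close>.\<close>
    moreover have "real n * \<delta> = (real n * e\<^sup>2) * (D / 2 + 24 * K * e)"
      by (simp add: \<delta>_def power2_eq_square power3_eq_cube algebra_simps)
    moreover have "real n * e\<^sup>2 = 1" using e2 n by simp
    ultimately show ?thesis by (simp add: e_def)
  qed
  have "(\<lambda>n. F (indicator B) - D / 2 - 24 * K * inverse (sqrt (real n))) \<longlonglongrightarrow> F (indicator B) - D / 2 - 24 * K * 0"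
    by (intro tendsto_intros tendsto_inverse_0_at_top filterlim_compose[OF sqrt_at_top] filterlim_real_sequentially)
  then have "F (indicator B) - D / 2 - 24 * K * 0 \<le> F (indicator A)"
    by (rule LIMSEQ_le_const2) (use path in \<open>auto intro!: exI[of _ 1]\<close>)
  then show "(\<integral>x. f B x \<partial>gaussV I) - D / 2 \<le> (\<integral>x. f A x \<partial>gaussV I)"
    using F_end[OF AI] F_end[OF BI] by simp
qed

section \<open>Fekete's lemma\<close>

lemma fekete_superadditive:
  fixes a :: "nat \<Rightarrow> real"
  assumes super: "\<And>m n. a m + a n \<le> a (m + n)"
    and bound: "\<And>n. n \<ge> 1 \<Longrightarrow> a n / real n \<le> C"
  shows "(\<lambda>n. a n / real n) \<longlonglongrightarrow> (SUP n\<in>{1..}. a n / real n)"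
proof -
  define S where "S = (SUP n\<in>{1..}. a n / real n)"
  have bdd: "bdd_above ((\<lambda>n. a n / real n) ` {1..})"
    using bound by (intro bdd_aboveI2[of _ _ C]) auto
  have "(\<lambda>n. a n / real n) \<longlonglongrightarrow> S"
  proof (rule order_tendstoI)
    fix y assume y: "y < S"
    then obtain m where m: "m \<ge> 1" "y < a m / real m"
      unfolding S_def by (subst (asm) less_cSUP_iff[OF _ bdd]) auto
    \<comment> \<open>\<open>K\<close> absorbs the term \<open>a r\<close> of the incomplete last
      block, which may be negative.\<close>
    define K where "K = (\<Sum>r<m. \<bar>a r\<bar>)"
    have block: "real q * a m - K \<le> a (q * m + r)" if "r < m" for q r
    proof (induction q)
      case 0
      have "\<bar>a r\<bar> \<le> K"
        unfolding K_def using that by (intro member_le_sum) auto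
      then show ?case by simp
    next
      case (Suc q)
      then show ?case using super[of m "q * m + r"] by (simp add: algebra_simps)
    qed
    \<comment> \<open>Division with remainder gives \<open>q = (n - r) / m\<close>; replacing this
      by \<open>n / m\<close> costs at most \<open>\<bar>a m\<bar>\<close>.\<close>
    have lower: "a m / real m - (\<bar>a m\<bar> + K) / real n \<le> a n / real n" if n: "n \<ge> 1" for n
    proof -
      define q where "q = n div m"
      define r where "r = n mod m"
      have nqr: "n = q * m + r" and r: "r < m" using m by (auto simp: q_def r_def)
      have "real n = real q * real m + real r"
        using arg_cong[OF nqr, of real] by simp
      then have q: "real q = (real n - real r) / real m"
        using m by (simp add: field_simps)
      have "\<bar>real r / real m * a m\<bar> \<le> 1 * \<bar>a m\<bar>"
        unfolding abs_mult using r by (intro mult_right_mono) auto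
      then have "real r / real m * a m \<le> \<bar>a m\<bar>"
        using abs_ge_self[of "real r / real m * a m"] by linarith
      then have "real n * (a m / real m) - (\<bar>a m\<bar> + K) \<le> real q * a m - K"
        unfolding q by (simp add: field_simps diff_divide_distrib)
      also have "\<dots> \<le> a n" using block[OF r, of q] nqr by simp
      finally have "(real n * (a m / real m) - (\<bar>a m\<bar> + K)) / real n \<le> a n / real n"
        by (rule divide_right_mono) simp
      moreover have "(real n * c - k) / real n = c - k / real n" for c k
        using n by (simp add: diff_divide_distrib)
      ultimately show ?thesis by (simp only:)
    qed
    have "(\<lambda>n. a m / real m - (\<bar>a m\<bar> + K) / real n) \<longlonglongrightarrow> a m / real m - 0"
      by (intro tendsto_diff tendsto_const lim_const_over_n)
    then have "eventually (\<lambda>n. y < a m / real m - (\<bar>a m\<bar> + K) / real n) sequentially"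
      using m(2) by (auto dest: order_tendstoD)
    then show "eventually (\<lambda>n. y < a n / real n) sequentially"
      using eventually_ge_at_top[of 1] by eventually_elim (use lower in \<open>force intro: less_le_trans\<close>)
  next
    fix y assume y: "S < y"
    show "eventually (\<lambda>n. a n / real n < y) sequentially"
      using eventually_ge_at_top[of 1]
    proof eventually_elim
      case (elim n)
      then have "a n / real n \<le> S"
        unfolding S_def by (intro cSUP_upper bdd) auto
      then show ?case using y by simp
    qed
  qed
  then show ?thesis by (simp add: S_def)
qed

section \<open>The truncated model\<close>

text \<open>Selecting coordinates along an injection leaves a standard Gaussian vector. Averages
  over the joint vector of all couplings thereby reduce to averages over the couplings of a single
  system.\<close>

lemma gaussV_reindex:
  fixes G :: "('j \<Rightarrow> real) \<Rightarrow> real"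
  assumes f: "inj_on f K" "f ` K \<subseteq> I" and G [measurable]: "G \<in> borel_measurable (gaussV K)"
  shows "(\<integral>x. G (\<lambda>n\<in>K. x (f n)) \<partial>gaussV I) = (\<integral>x. G x \<partial>gaussV K)"
    and "integrable (gaussV I) (\<lambda>x. G (\<lambda>n\<in>K. x (f n))) \<longleftrightarrow> integrable (gaussV K) G"
proof -
  have d: "distr (gaussV I) (gaussV K) (\<lambda>x. \<lambda>n\<in>K. x (f n)) = gaussV K"
    using f by (intro distr_PiM_reindex prob_space_gauss) auto
  have "f n \<in> I" if "n \<in> K" for n
    using f(2) that by auto
  then have [measurable]: "(\<lambda>x. \<lambda>n\<in>K. x (f n)) \<in> gaussV I \<rightarrow>\<^sub>M gaussV K"
    by (intro measurable_restrict) simp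
  show "(\<integral>x. G (\<lambda>n\<in>K. x (f n)) \<partial>gaussV I) = (\<integral>x. G x \<partial>gaussV K)"
    using integral_distr[of "\<lambda>x. \<lambda>n\<in>K. x (f n)" "gaussV I" "gaussV K" G] by (simp add: d)
  show "integrable (gaussV I) (\<lambda>x. G (\<lambda>n\<in>K. x (f n))) \<longleftrightarrow> integrable (gaussV K) G"
    using integrable_distr_eq[of "\<lambda>x. \<lambda>n\<in>K. x (f n)" "gaussV I" "gaussV K" G] by (simp add: d)
qed

text \<open>Tonelli for the concatenation of two blocks, the second one shifted by
  \<open>N1\<close>. Nonnegative integrals make integrability a non-issue: an infinite value becomes
  0 under the multiplicative map \<open>enn2real\<close>, in agreement with the Bochner
  integral.\<close>

lemma integral_gaussN_add:
  fixes g1 g2 :: "(nat \<Rightarrow> real) \<Rightarrow> real"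
  assumes [measurable]: "g1 \<in> borel_measurable (gaussN N1)" "g2 \<in> borel_measurable (gaussN N2)"
    and nn: "\<And>z. 0 \<le> g1 z" "\<And>z. 0 \<le> g2 z"
  shows "(\<integral>z. g1 (\<lambda>i\<in>{1..N1}. z i) * g2 (\<lambda>i\<in>{1..N2}. z (N1 + i)) \<partial>gaussN (N1 + N2)) =
    (\<integral>z. g1 z \<partial>gaussN N1) * (\<integral>z. g2 z \<partial>gaussN N2)"
proof -
  define J where "J = {N1 + 1..N1 + N2}"
  define s where "s z = (\<lambda>i\<in>{1..N2}. z (N1 + i))" for z :: "nat \<Rightarrow> real"
  have un: "{1..N1 + N2} = {1..N1} \<union> J" "{1..N1} \<inter> J = {}" "finite J"
    by (auto simp: J_def)
  have in1: "i \<in> {1..N1} \<Longrightarrow> i \<in> {1..N1 + N2}" and in2: "i \<in> {1..N2} \<Longrightarrow> N1 + i \<in> {1..N1 + N2}"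
    and in3: "i \<in> {1..N2} \<Longrightarrow> N1 + i \<in> J" for i
    by (auto simp: J_def)
  have ms1: "(\<lambda>z. \<lambda>i\<in>{1..N1}. z i) \<in> gaussN (N1 + N2) \<rightarrow>\<^sub>M gaussN N1"
    unfolding gaussN_def by (rule measurable_restrict) (use in1 in simp)
  have ms2: "s \<in> gaussN (N1 + N2) \<rightarrow>\<^sub>M gaussN N2"
    unfolding gaussN_def s_def by (rule measurable_restrict) (use in2 in simp)
  have ms3: "s \<in> gaussV J \<rightarrow>\<^sub>M gaussN N2"
    unfolding gaussN_def s_def by (rule measurable_restrict) (use in3 in simp)
  note [measurable] = ms1 ms2 ms3
  have d: "distr (gaussV J) (gaussN N2) s = gaussN N2"
    unfolding s_def gaussN_def by (intro distr_PiM_reindex prob_space_gauss) (auto simp: J_def inj_on_def)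
  have measR: "(\<lambda>z. g1 (\<lambda>i\<in>{1..N1}. z i) * g2 (s z)) \<in> borel_measurable (gaussN (N1 + N2))"
    by (intro borel_measurable_times measurable_compose[OF ms1 assms(1)] measurable_compose[OF ms2 assms(2)])
  then have meas: "(\<lambda>z. ennreal (g1 (\<lambda>i\<in>{1..N1}. z i) * g2 (s z))) \<in> borel_measurable (gaussN (N1 + N2))"
    by measurable
  have "(\<integral>\<^sup>+z. ennreal (g1 (\<lambda>i\<in>{1..N1}. z i) * g2 (s z)) \<partial>gaussN (N1 + N2)) =
    (\<integral>\<^sup>+x. \<integral>\<^sup>+y. ennreal (g1 (\<lambda>i\<in>{1..N1}. merge {1..N1} J (x, y) i) * g2 (s (merge {1..N1} J (x, y)))) \<partial>gaussV J \<partial>gaussV {1..N1})"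
    unfolding gaussN_def un(1)
    by (rule gauss_prod.product_nn_integral_fold[OF un(2) _ un(3) meas[unfolded gaussN_def un(1)]]) simp
  also have "\<dots> = (\<integral>\<^sup>+x. \<integral>\<^sup>+y. ennreal (g1 x) * ennreal (g2 (s y)) \<partial>gaussV J \<partial>gaussN N1)"
    unfolding gaussN_def
  proof (intro nn_integral_cong)
    fix x y assume x: "x \<in> space (gaussV {1..N1})" and y: "y \<in> space (gaussV J)"
    have "(\<lambda>i\<in>{1..N1}. merge {1..N1} J (x, y) i) = x"
      using x by (auto simp: merge_def space_PiM PiE_def extensional_def fun_eq_iff)
    moreover have "s (merge {1..N1} J (x, y)) = s y"
      by (auto simp: s_def merge_def J_def fun_eq_iff)
    ultimately show "ennreal (g1 (\<lambda>i\<in>{1..N1}. merge {1..N1} J (x, y) i) * g2 (s (merge {1..N1} J (x, y))))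
      = ennreal (g1 x) * ennreal (g2 (s y))"
      using nn by (simp add: ennreal_mult)
  qed
  also have "\<dots> = (\<integral>\<^sup>+x. ennreal (g1 x) \<partial>gaussN N1) * (\<integral>\<^sup>+y. ennreal (g2 (s y)) \<partial>gaussV J)"
    by (simp add: nn_integral_cmult nn_integral_multc)
  also have "(\<integral>\<^sup>+y. ennreal (g2 (s y)) \<partial>gaussV J) = (\<integral>\<^sup>+y. ennreal (g2 y) \<partial>gaussN N2)"
    using nn_integral_distr[of s "gaussV J" "gaussN N2" "\<lambda>y. ennreal (g2 y)"] by (simp add: d)
  finally have eq: "(\<integral>\<^sup>+z. ennreal (g1 (\<lambda>i\<in>{1..N1}. z i) * g2 (s z)) \<partial>gaussN (N1 + N2)) =
    (\<integral>\<^sup>+x. ennreal (g1 x) \<partial>gaussN N1) * (\<integral>\<^sup>+y. ennreal (g2 y) \<partial>gaussN N2)" .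
  have "(\<integral>z. g1 (\<lambda>i\<in>{1..N1}. z i) * g2 (s z) \<partial>gaussN (N1 + N2)) =
    enn2real (\<integral>\<^sup>+z. ennreal (g1 (\<lambda>i\<in>{1..N1}. z i) * g2 (s z)) \<partial>gaussN (N1 + N2))"
    using nn measR by (intro integral_eq_nn_integral) auto
  also have "\<dots> = (\<integral>z. g1 z \<partial>gaussN N1) * (\<integral>z. g2 z \<partial>gaussN N2)"
    unfolding eq enn2real_mult using nn by (simp add: integral_eq_nn_integral[OF assms(1)] integral_eq_nn_integral[OF assms(2)])
  finally show ?thesis by (simp add: s_def)
qed

text \<open>The density is positive everywhere, so a Gaussian null set is a Lebesgue null set, which
  the interval is not.\<close>

lemma gauss_interval_pos: "0 < measure gauss {- r..r}" if "r > 0"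
proof (rule ccontr)
  assume "\<not> 0 < measure gauss {- r..r}"
  then have "emeasure gauss {- r..r} = 0"
    using gauss.emeasure_eq_measure by (simp add: zero_less_measure_iff)
  then have "AE x in gauss. x \<notin> {- r..r}"
    by (intro AE_not_in) (auto simp: null_sets_def)
  then have "AE x in lborel. x \<notin> {- r..r}"
    unfolding gauss_def by (subst (asm) AE_density) (auto simp: normal_density_pos)
  then have "emeasure lborel {- r..r} = 0"
    by (subst (asm) AE_iff_measurable[of "{- r..r}"]) auto
  then show False using that by simp
qed

text \<open>A box rather than a ball: the box of a concatenated system is the product of the boxes
  of its blocks, so truncated partition functions of independent blocks still multiply.\<close>

definition cube :: "nat \<Rightarrow> real \<Rightarrow> (nat \<Rightarrow> real) set" where
  "cube N r = {z \<in> space (gaussN N). \<forall>i\<in>{1..N}. \<bar>z i\<bar> \<le> r}"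

lemma space_gaussN: "space (gaussN N) = extensional {1..N}"
  by (simp add: gaussN_def space_PiM PiE_def)

lemma prob_space_gaussN: "prob_space (gaussN N)"
  unfolding gaussN_def by (rule prob_space_gaussV)

lemma cube_sets [measurable]: "cube N r \<in> sets (gaussN N)"
  unfolding cube_def gaussN_def by measurable

lemma cube_pos:
  assumes "r > 0"
  shows "0 < measure (gaussN N) (cube N r)"
proof -
  have "cube N r = PiE {1..N} (\<lambda>_. {- r..r})"
    by (auto simp: cube_def space_gaussN PiE_def abs_le_iff Pi_iff) (smt (verit) atLeastAtMost_iff)+
  then have "emeasure (gaussN N) (cube N r) = (\<Prod>i\<in>{1..N}. emeasure gauss {- r..r})"
    unfolding gaussN_def by (simp add: gauss_prod.emeasure_PiM)
  also have "\<dots> \<noteq> 0"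
    using gauss_interval_pos[OF assms] by (simp add: gauss.emeasure_eq_measure)
  finally show ?thesis
    using prob_space_gaussN[THEN prob_space.finite_measure]
    by (simp add: finite_measure.emeasure_eq_measure less_le)
qed

text \<open>Left unnormalised: the comparison accepts any finite measure of positive mass, and
  without normalisation the truncated partition functions increase with \<open>r\<close>.\<close>

definition cubeM :: "nat \<Rightarrow> real \<Rightarrow> (nat \<Rightarrow> real) measure" where
  "cubeM N r = restrict_space (gaussN N) (cube N r)"

lemma space_cubeM: "space (cubeM N r) = cube N r"
  by (auto simp: cubeM_def space_restrict_space cube_def)

lemma cube_bound: "z \<in> cube N r \<Longrightarrow> i \<in> {1..N} \<Longrightarrow> \<bar>z i\<bar> \<le> r"
  by (simp add: cube_def)

lemma measurable_cubeM: "f \<in> borel_measurable (gaussN N) \<Longrightarrow> f \<in> borel_measurable (cubeM N r)"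
  unfolding cubeM_def by (rule measurable_restrict_space1)

lemma measure_cubeM: "measure (cubeM N r) (space (cubeM N r)) = measure (gaussN N) (cube N r)"
  unfolding space_cubeM unfolding cubeM_def
  by (rule measure_restrict_space) (use sets.sets_into_space[OF cube_sets] in \<open>auto simp: Int_absorb2\<close>)

lemma finite_measure_cubeM: "finite_measure (cubeM N r)"
  unfolding cubeM_def using prob_space_gaussN
  by (intro finite_measure_restrict_space) (auto simp: prob_space_def)

lemma integral_cubeM: "(\<integral>z. f z \<partial>cubeM N r) = (\<integral>z. indicator (cube N r) z * f z \<partial>gaussN N)" for f :: "_ \<Rightarrow> real"
  unfolding cubeM_def using sets.sets_into_space[OF cube_sets]
  by (subst integral_restrict_space) (auto simp: Int_absorb2)

lemma gaussN_component [measurable]: "i \<in> {1..N} \<Longrightarrow> (\<lambda>z. z i) \<in> borel_measurable (gaussN N)"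
  using measurable_component_singleton[of i "{1..N}" "\<lambda>_. gauss"]
    measurable_cong_sets[OF refl sets_gauss] unfolding gaussN_def by blast

lemma disorder_component [measurable]:
  "i \<in> {1..N} \<Longrightarrow> j \<in> {1..N} \<Longrightarrow> (\<lambda>J. J (i, j)) \<in> borel_measurable (disorder N)"
  using measurable_component_singleton[of "(i, j)" "{1..N} \<times> {1..N}" "\<lambda>_. gauss"]
    measurable_cong_sets[OF refl sets_gauss] unfolding disorder_def by blast

lemma sum_block: "(\<Sum>a\<in>{k} \<times> (X \<times> Y). g a) = (\<Sum>i\<in>X. \<Sum>j\<in>Y. g (k, i, j))"
  by (simp add: sum.cartesian_product')

text \<open>The covariance of the interaction at two points depends only on the square of their
  overlap; at \<open>w = z\<close> it produces the quartic term.\<close>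

lemma sum_rank_one:
  "(\<Sum>i\<in>X. \<Sum>j\<in>X. (c * z i * z j) * (c * w i * w j)) = c\<^sup>2 * (\<Sum>i\<in>X. z i * w i)\<^sup>2" for c :: real
proof -
  have "(c * z i * z j) * (c * w i * w j) = c\<^sup>2 * ((z i * w i) * (z j * w j))" for i j
    by (simp add: power2_eq_square)
  then show ?thesis
    unfolding power2_eq_square[of "sum _ _"] sum_product by (simp only: sum_distrib_left)
qed

lemma sum_shift_split:
  fixes g :: "nat \<Rightarrow> real"
  shows "(\<Sum>i\<in>{1..m + n}. g i) = (\<Sum>i\<in>{1..m}. g i) + (\<Sum>i\<in>{1..n}. g (m + i))"
  using sum.ub_add_nat[of 1 m g n] sum.shift_bounds_cl_nat_ivl[of g 1 m n]
  by (simp add: add.commute)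

section \<open>The Hamiltonian as a one-body term plus a compensated Gaussian field\<close>

locale spin_glass =
  fixes \<beta> lam h :: real
  assumes \<beta>: "\<beta> > 0"
begin

definition energy :: "nat \<Rightarrow> (nat \<times> nat \<Rightarrow> real) \<Rightarrow> (nat \<Rightarrow> real) \<Rightarrow> real" where
  "energy N J z = \<beta> / sqrt (2 * real N) * (\<Sum>i\<in>{1..N}. \<Sum>j\<in>{1..N}. J (i, j) * z i * z j)
              + \<beta> * h * (\<Sum>i\<in>{1..N}. z i)
              - \<beta>\<^sup>2 / (4 * real N) * (\<Sum>i\<in>{1..N}. (z i)\<^sup>2)\<^sup>2
              + lam / 2 * (\<Sum>i\<in>{1..N}. (z i)\<^sup>2)"

definition coupling :: "nat \<Rightarrow> real" where
  "coupling N = \<beta> / sqrt (2 * real N)"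

text \<open>The nonrandom part without the quartic term. It is the \<open>W\<close> of the
  comparison, shared by the competing fields, and it is additive over blocks.\<close>

definition one_body :: "nat \<Rightarrow> (nat \<Rightarrow> real) \<Rightarrow> real" where
  "one_body N z = \<beta> * h * (\<Sum>i\<in>{1..N}. z i) + lam / 2 * (\<Sum>i\<in>{1..N}. (z i)\<^sup>2)"

definition Zc :: "nat \<Rightarrow> real \<Rightarrow> (nat \<times> nat \<Rightarrow> real) \<Rightarrow> real" where
  "Zc N r J = (\<integral>z. indicator (cube N r) z * exp (energy N J z) \<partial>gaussN N)"

definition free_energy :: "nat \<Rightarrow> real \<Rightarrow> real" where
  "free_energy N r = (\<integral>J. ln (Zc N r J) \<partial>disorder N)"

lemma coupling_sq: "(coupling N)\<^sup>2 = \<beta>\<^sup>2 / (2 * real N)"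
  by (simp add: coupling_def power_divide)

lemma coupling_nonneg: "0 \<le> coupling N"
  using \<beta> by (simp add: coupling_def)

lemma energy_eq:
  "energy N J z = one_body N z + (\<Sum>i\<in>{1..N}. \<Sum>j\<in>{1..N}. J (i, j) * (coupling N * z i * z j))
    - (\<Sum>i\<in>{1..N}. \<Sum>j\<in>{1..N}. (coupling N * z i * z j)\<^sup>2) / 2"
proof -
  have "(\<Sum>i\<in>{1..N}. \<Sum>j\<in>{1..N}. (coupling N * z i * z j)\<^sup>2) = \<beta>\<^sup>2 / (2 * real N) * (\<Sum>i\<in>{1..N}. (z i)\<^sup>2)\<^sup>2"
    using sum_rank_one[of "coupling N" z z "{1..N}"] by (simp only: power2_eq_square[symmetric] coupling_sq)
  moreover have "(\<Sum>i\<in>{1..N}. \<Sum>j\<in>{1..N}. J (i, j) * (coupling N * z i * z j)) =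
    coupling N * (\<Sum>i\<in>{1..N}. \<Sum>j\<in>{1..N}. J (i, j) * z i * z j)"
    by (simp add: sum_distrib_left mult_ac)
  ultimately show ?thesis
    by (simp add: energy_def one_body_def coupling_def)
qed

lemma one_body_measurable [measurable]: "one_body N \<in> borel_measurable (gaussN N)"
  unfolding one_body_def by measurable

lemma energy_measurable [measurable]: "energy N J \<in> borel_measurable (gaussN N)"
  unfolding energy_def by measurable

lemma energy_measurable_pair:
  "(\<lambda>p. energy N (fst p) (snd p)) \<in> borel_measurable (disorder N \<Otimes>\<^sub>M gaussN N)"
proof -
  have J: "(\<lambda>p. fst p (i, j)) \<in> borel_measurable (disorder N \<Otimes>\<^sub>M gaussN N)" if "i \<in> {1..N}" "j \<in> {1..N}" for i j
    by (rule measurable_compose[OF measurable_fst disorder_component[OF that]])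
  have z: "(\<lambda>p. snd p i) \<in> borel_measurable (disorder N \<Otimes>\<^sub>M gaussN N)" if "i \<in> {1..N}" for i
    by (rule measurable_compose[OF measurable_snd gaussN_component[OF that]])
  show ?thesis
    unfolding energy_def
    by (intro borel_measurable_add borel_measurable_diff borel_measurable_times borel_measurable_const
        borel_measurable_sum borel_measurable_power J z)
qed

lemma Zc_measurable [measurable]: "Zc N r \<in> borel_measurable (disorder N)"
  unfolding Zc_def
proof (rule sigma_finite_measure.borel_measurable_lebesgue_integral)
  show "sigma_finite_measure (gaussN N)"
    by (intro prob_space_imp_sigma_finite prob_space_gaussN)
  have "(\<lambda>z. indicator (cube N r) z :: real) \<in> borel_measurable (gaussN N)"
    by measurable
  then have "(\<lambda>p. indicator (cube N r) (snd p) :: real) \<in> borel_measurable (disorder N \<Otimes>\<^sub>M gaussN N)"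
    by (rule measurable_compose[OF measurable_snd])
  then show "(\<lambda>(J, z). indicator (cube N r) z * exp (energy N J z)) \<in> borel_measurable (disorder N \<Otimes>\<^sub>M gaussN N)"
    unfolding case_prod_beta
    by (intro borel_measurable_times measurable_compose[OF energy_measurable_pair borel_measurable_exp])
qed

lemma energy_restrict:
  "energy N (\<lambda>p\<in>{1..N} \<times> {1..N}. J p) z = energy N J z"
  "energy N J (\<lambda>i\<in>{1..N}. z i) = energy N J z"
  by (simp_all add: energy_def)

lemma one_body_bound:
  assumes "z \<in> cube N r"
  shows "\<bar>one_body N z\<bar> \<le> \<bar>\<beta> * h\<bar> * (real N * r) + \<bar>lam / 2\<bar> * (real N * r\<^sup>2)"
proof -
  have "\<bar>\<Sum>i\<in>{1..N}. z i\<bar> \<le> (\<Sum>i\<in>{1..N}. \<bar>z i\<bar>)" by (rule sum_abs)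
  also have "\<dots> \<le> real (card {1..N}) * r"
    using cube_bound[OF assms] by (intro sum_bounded_above) auto
  finally have 1: "\<bar>\<Sum>i\<in>{1..N}. z i\<bar> \<le> real N * r" by simp
  have "(z i)\<^sup>2 \<le> r\<^sup>2" if "i \<in> {1..N}" for i
    using power_mono[OF cube_bound[OF assms that], of 2] by simp
  then have "(\<Sum>i\<in>{1..N}. (z i)\<^sup>2) \<le> real (card {1..N}) * r\<^sup>2"
    by (intro sum_bounded_above) auto
  then have 2: "\<bar>\<Sum>i\<in>{1..N}. (z i)\<^sup>2\<bar> \<le> real N * r\<^sup>2"
    by (simp add: sum_nonneg)
  have "\<bar>one_body N z\<bar> \<le> \<bar>\<beta> * h\<bar> * \<bar>\<Sum>i\<in>{1..N}. z i\<bar> + \<bar>lam / 2\<bar> * \<bar>\<Sum>i\<in>{1..N}. (z i)\<^sup>2\<bar>"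
    unfolding one_body_def abs_mult[symmetric] by (rule abs_triangle_ineq)
  also have "\<dots> \<le> \<bar>\<beta> * h\<bar> * (real N * r) + \<bar>lam / 2\<bar> * (real N * r\<^sup>2)"
    using 1 2 by (intro add_mono mult_left_mono) auto
  finally show ?thesis .
qed

lemma interaction_bound:
  assumes "z \<in> cube N r" "i \<in> {1..N}" "j \<in> {1..N}" "0 \<le> c"
  shows "\<bar>c * z i * z j\<bar> \<le> c * r\<^sup>2"
proof -
  have "\<bar>z i\<bar> * \<bar>z j\<bar> \<le> r * r"
    using cube_bound[OF assms(1,2)] cube_bound[OF assms(1,3)] by (intro mult_mono) auto
  then show ?thesis
    using assms(4) by (simp add: abs_mult power2_eq_square mult.assoc mult_left_mono)
qed

lemma ln_Zc_reindex:
  assumes "{k} \<times> ({1..N} \<times> {1..N}) \<subseteq> I"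
  shows "(\<integral>x. ln (Zc N r (\<lambda>p. x (k, p))) \<partial>gaussV I) = free_energy N r"
    and "integrable (gaussV I) (\<lambda>x. ln (Zc N r (\<lambda>p. x (k, p)))) \<longleftrightarrow> integrable (disorder N) (\<lambda>J. ln (Zc N r J))"
proof -
  have *: "Zc N r (\<lambda>p. x (k, p)) = Zc N r (\<lambda>p\<in>{1..N} \<times> {1..N}. x (k, p))" for x
    by (simp only: Zc_def energy_restrict(1))
  have inj: "inj_on (Pair k) ({1..N} \<times> {1..N})" "Pair k ` ({1..N} \<times> {1..N}) \<subseteq> I"
    using assms by (auto simp: inj_on_def)
  have m: "(\<lambda>J. ln (Zc N r J)) \<in> borel_measurable (gaussV ({1..N} \<times> {1..N}))"
    unfolding disorder_def[symmetric] by measurable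
  show "(\<integral>x. ln (Zc N r (\<lambda>p. x (k, p))) \<partial>gaussV I) = free_energy N r"
    unfolding * free_energy_def disorder_def by (rule gaussV_reindex(1)[OF inj m])
  show "integrable (gaussV I) (\<lambda>x. ln (Zc N r (\<lambda>p. x (k, p)))) \<longleftrightarrow> integrable (disorder N) (\<lambda>J. ln (Zc N r J))"
    unfolding * disorder_def by (rule gaussV_reindex(2)[OF inj m])
qed

section \<open>Upper bound\<close>

lemma Zc_cubeM: "Zc N r J = (\<integral>z. exp (energy N J z) \<partial>cubeM N r)"
  by (simp only: Zc_def integral_cubeM)

lemma one_body_measurable_cubeM: "one_body N \<in> borel_measurable (cubeM N r)"
  by (rule measurable_cubeM) measurable

lemma Zc_pos:
  assumes "r > 0"
  shows "0 < Zc N r J" "integrable (cubeM N r) (\<lambda>z. exp (energy N J z))"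
proof -
  interpret finite_measure "cubeM N r" by (rule finite_measure_cubeM)
  define C where "C = \<bar>\<beta> * h\<bar> * (real N * r) + \<bar>lam / 2\<bar> * (real N * r\<^sup>2)
    + (\<Sum>i\<in>{1..N}. \<Sum>j\<in>{1..N}. \<bar>J (i, j)\<bar> * (coupling N * r\<^sup>2))
    + (\<Sum>i\<in>{1..N}. \<Sum>j\<in>{1..N}. (coupling N * r\<^sup>2)\<^sup>2) / 2"
  have b: "\<bar>energy N J z\<bar> \<le> C" if "z \<in> space (cubeM N r)" for z
  proof -
    have z: "z \<in> cube N r" using that by (simp add: space_cubeM)
    note ib = interaction_bound[OF z _ _ coupling_nonneg[of N]]
    have 1: "\<bar>\<Sum>i\<in>{1..N}. \<Sum>j\<in>{1..N}. J (i, j) * (coupling N * z i * z j)\<bar>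
      \<le> (\<Sum>i\<in>{1..N}. \<Sum>j\<in>{1..N}. \<bar>J (i, j)\<bar> * (coupling N * r\<^sup>2))"
    proof (intro order_trans[OF sum_abs] sum_mono)
      fix i j assume "i \<in> {1..N}" "j \<in> {1..N}"
      then show "\<bar>J (i, j) * (coupling N * z i * z j)\<bar> \<le> \<bar>J (i, j)\<bar> * (coupling N * r\<^sup>2)"
        unfolding abs_mult[of "J (i, j)"] using ib by (intro mult_left_mono) auto
    qed
    have 2: "(\<Sum>i\<in>{1..N}. \<Sum>j\<in>{1..N}. (coupling N * z i * z j)\<^sup>2) \<le> (\<Sum>i\<in>{1..N}. \<Sum>j\<in>{1..N}. (coupling N * r\<^sup>2)\<^sup>2)"
    proof (intro sum_mono)
      fix i j assume "i \<in> {1..N}" "j \<in> {1..N}"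
      then show "(coupling N * z i * z j)\<^sup>2 \<le> (coupling N * r\<^sup>2)\<^sup>2"
        using power_mono[OF ib[of i j], of 2] by simp
    qed
    have 3: "0 \<le> (\<Sum>i\<in>{1..N}. \<Sum>j\<in>{1..N}. (coupling N * z i * z j)\<^sup>2)"
      by (intro sum_nonneg) auto
    show ?thesis
      unfolding energy_eq C_def using 1 2 3 one_body_bound[OF z] by linarith
  qed
  have m: "energy N J \<in> borel_measurable (cubeM N r)"
    by (rule measurable_cubeM) measurable
  have p: "0 < measure (cubeM N r) (space (cubeM N r))"
    unfolding measure_cubeM by (rule cube_pos[OF assms])
  show "0 < Zc N r J" "integrable (cubeM N r) (\<lambda>z. exp (energy N J z))"
    unfolding Zc_cubeM using ln_integral_exp_bound(1,2)[OF m b p] by auto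
qed

text \<open>The choice of \<open>a\<close> makes the coefficient \<open>(lam - a^2) / 2\<close> of
  \<open>(z i)^2\<close> at most \<open>-1/2\<close>. With \<open>t = a * x i + \<beta> * h\<close>,
  each summand is then at most the maximum \<open>t^2 / 2\<close> of \<open>t u - u^2 / 2\<close>
  over \<open>u\<close>, which no longer depends on \<open>z\<close>.\<close>

lemma linear_field_bound:
  assumes a: "a\<^sup>2 = \<bar>lam\<bar> + 1"
  shows "one_body N z + (\<Sum>i\<in>{1..N}. x i * (a * z i)) - (\<Sum>i\<in>{1..N}. (a * z i)\<^sup>2) / 2
    \<le> (\<Sum>i\<in>{1..N}. (a * x i + \<beta> * h)\<^sup>2 / 2)"
proof -
  have "\<beta> * h * u + lam / 2 * u\<^sup>2 + y * (a * u) - (a * u)\<^sup>2 / 2 \<le> (a * y + \<beta> * h)\<^sup>2 / 2" for u y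
  proof -
    have "lam * u\<^sup>2 \<le> \<bar>lam\<bar> * u\<^sup>2" by (intro mult_right_mono) auto
    moreover have "(a * u)\<^sup>2 = \<bar>lam\<bar> * u\<^sup>2 + u\<^sup>2"
      by (simp add: power_mult_distrib a algebra_simps)
    moreover have "0 \<le> (a * y + \<beta> * h - u)\<^sup>2" by simp
    then have "2 * (a * y + \<beta> * h) * u \<le> (a * y + \<beta> * h)\<^sup>2 + u\<^sup>2"
      by (simp add: power2_eq_square algebra_simps)
    ultimately have "2 * (a * y + \<beta> * h) * u + lam * u\<^sup>2 - (a * u)\<^sup>2 \<le> (a * y + \<beta> * h)\<^sup>2"
      by linarith
    moreover have "\<beta> * h * u + lam / 2 * u\<^sup>2 + y * (a * u) - (a * u)\<^sup>2 / 2 =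
      (2 * (a * y + \<beta> * h) * u + lam * u\<^sup>2 - (a * u)\<^sup>2) / 2"
      by (simp add: field_simps)
    ultimately show ?thesis by (simp only: divide_right_mono)
  qed
  then have "(\<Sum>i\<in>{1..N}. \<beta> * h * z i + lam / 2 * (z i)\<^sup>2 + x i * (a * z i) - (a * z i)\<^sup>2 / 2)
    \<le> (\<Sum>i\<in>{1..N}. (a * x i + \<beta> * h)\<^sup>2 / 2)"
    by (intro sum_mono)
  then show ?thesis
    by (simp only: one_body_def sum.distrib sum_subtractf sum_distrib_left sum_divide_distrib)
qed

text \<open>With \<open>a^2 = \<bar>lam\<bar> + 1\<close>, the first summand is the Gaussian mean of
  \<open>(a * x + \<beta> * h)^2 / 2\<close> at one site; the second is the comparison cost
  \<open>D / 2\<close> divided by \<open>N\<close>.\<close>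

definition pressure_bound :: real where
  "pressure_bound = (\<bar>lam\<bar> + 1 + (\<beta> * h)\<^sup>2) / 2 + (\<bar>lam\<bar> + 1)\<^sup>2 / (4 * \<beta>\<^sup>2)"

text \<open>The model takes the role of the larger covariance, so its free energy is at most that of
  the linear field plus \<open>D / 2\<close>. The linear field decouples and is bounded site by
  site, uniformly in \<open>r\<close>. Integrability in the disorder comes with the
  comparison.\<close>

lemma free_energy_upper:
  assumes N: "N \<ge> 1" and r: "r > 0"
  shows "free_energy N r \<le> real N * pressure_bound" "integrable (disorder N) (\<lambda>J. ln (Zc N r J))"
proof -
  define a where "a = sqrt (\<bar>lam\<bar> + 1)"
  have a: "a\<^sup>2 = \<bar>lam\<bar> + 1" "0 \<le> a" by (simp_all add: a_def)
  \<comment> \<open>Label 0 marks the couplings of the model, label 1 the linear field, whose last index is a dummy.\<close>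
  define B where "B = {0::nat} \<times> ({1..N} \<times> {1..N})"
  define A where "A = {1::nat} \<times> ({1..N} \<times> {0::nat})"
  define I where "I = A \<union> B"
  define \<phi> :: "nat \<times> nat \<times> nat \<Rightarrow> (nat \<Rightarrow> real) \<Rightarrow> real" where "\<phi> = (\<lambda>(k::nat, i, j) z. if k = 0 then coupling N * z i * z j else a * z i)"
  \<comment> \<open>The largest excess of \<open>(\<bar>lam\<bar> + 1) * q\<close> over
    \<open>\<beta>^2 / (2 N) * q^2\<close>, attained at
    \<open>q = (\<bar>lam\<bar> + 1) N / \<beta>^2\<close>. It is proportional to \<open>N\<close>,
    so the cost per site stays bounded.\<close>
  define D where "D = (\<bar>lam\<bar> + 1)\<^sup>2 * real N / (2 * \<beta>\<^sup>2)"
  define b where "b = coupling N * r\<^sup>2 + a * r"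
  interpret finite_measure "cubeM N r" by (rule finite_measure_cubeM)
  have fin: "finite I" "A \<subseteq> I" "B \<subseteq> I" "A \<inter> B = {}" by (auto simp: I_def A_def B_def)
  have sumB: "(\<Sum>s\<in>B. g s) = (\<Sum>i\<in>{1..N}. \<Sum>j\<in>{1..N}. g (0, i, j))" for g :: "_ \<Rightarrow> real"
    unfolding B_def by (rule sum_block)
  have sumA: "(\<Sum>s\<in>A. g s) = (\<Sum>i\<in>{1..N}. g (1, i, 0))" for g :: "_ \<Rightarrow> real"
    unfolding A_def sum_block by simp
  have \<phi>m: "\<phi> s \<in> borel_measurable (cubeM N r)" if "s \<in> I" for s
  proof (rule measurable_cubeM)
    obtain k i j where s: "s = (k, i, j)" by (cases s)
    show "\<phi> s \<in> borel_measurable (gaussN N)"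
    proof (cases "k = 0")
      case True
      then have "i \<in> {1..N}" "j \<in> {1..N}" using that s by (auto simp: I_def A_def B_def)
      then show ?thesis using True by (simp add: s \<phi>_def)
    next
      case False
      then have "i \<in> {1..N}" using that s by (auto simp: I_def A_def B_def)
      then show ?thesis using False by (simp add: s \<phi>_def)
    qed
  qed
  have \<phi>b: "\<bar>\<phi> s z\<bar> \<le> b" if "s \<in> I" "z \<in> space (cubeM N r)" for s z
  proof -
    have z: "z \<in> cube N r" using that by (simp add: space_cubeM)
    obtain k i j where s: "s = (k, i, j)" by (cases s)
    show ?thesis
    proof (cases "k = 0")
      case True
      then have "i \<in> {1..N}" "j \<in> {1..N}" using that s by (auto simp: I_def A_def B_def)
      then have "\<bar>\<phi> s z\<bar> \<le> coupling N * r\<^sup>2"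
        using interaction_bound[OF z _ _ coupling_nonneg] True by (simp add: s \<phi>_def)
      then show ?thesis using a r by (simp add: b_def add_increasing2)
    next
      case False
      then have "i \<in> {1..N}" using that s by (auto simp: I_def A_def B_def)
      then have "\<bar>\<phi> s z\<bar> \<le> a * r"
        using cube_bound[OF z] False a by (simp add: s \<phi>_def abs_mult mult_left_mono)
      then show ?thesis using coupling_nonneg[of N] by (simp add: b_def add_increasing)
    qed
  qed
  have ker: "(\<Sum>s\<in>A. \<phi> s z * \<phi> s w) \<le> (\<Sum>s\<in>B. \<phi> s z * \<phi> s w) + D" for z w
  proof -
    define q where "q = (\<Sum>i\<in>{1..N}. z i * w i)"
    have "(\<Sum>s\<in>A. \<phi> s z * \<phi> s w) = (\<bar>lam\<bar> + 1) * q"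
      unfolding sumA by (simp add: \<phi>_def q_def sum_distrib_left a(1)[symmetric] power2_eq_square mult_ac)
    moreover have "(\<Sum>s\<in>B. \<phi> s z * \<phi> s w) = \<beta>\<^sup>2 / (2 * real N) * q\<^sup>2"
      unfolding sumB q_def using sum_rank_one[of "coupling N" z w "{1..N}"] by (simp add: \<phi>_def coupling_sq)
    moreover have "(\<bar>lam\<bar> + 1) * q \<le> \<beta>\<^sup>2 / (2 * real N) * q\<^sup>2 + D"
    proof -
      have "0 \<le> (\<beta>\<^sup>2 * q - (\<bar>lam\<bar> + 1) * real N)\<^sup>2 / (2 * real N * \<beta>\<^sup>2)" by simp
      also have "\<dots> = \<beta>\<^sup>2 / (2 * real N) * q\<^sup>2 + D - (\<bar>lam\<bar> + 1) * q"
        unfolding D_def using N \<beta> by (simp add: power2_eq_square field_simps)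
      finally show ?thesis by simp
    qed
    ultimately show ?thesis by simp
  qed
  have pos: "0 < measure (cubeM N r) (space (cubeM N r))"
    unfolding measure_cubeM by (rule cube_pos[OF r])
  define f where "f S x = ln (\<integral>z. exp (one_body N z + (\<Sum>s\<in>S. x s * \<phi> s z) - (\<Sum>s\<in>S. (\<phi> s z)\<^sup>2) / 2) \<partial>cubeM N r)" for S x
  note comp = gaussian_comparison[where I = I and A = A and B = B and \<phi> = \<phi> and D = D, OF fin \<phi>m \<phi>b
    one_body_measurable_cubeM one_body_bound pos ker, unfolded space_cubeM, folded f_def]
  have fB: "f B x = ln (Zc N r (\<lambda>p. x (0, p)))" for x
    unfolding f_def Zc_cubeM sumB energy_eq by (simp add: \<phi>_def)
  have iB: "integrable (gaussV I) (f B)" and iA: "integrable (gaussV I) (f A)"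
    and le: "(\<integral>x. f B x \<partial>gaussV I) - D / 2 \<le> (\<integral>x. f A x \<partial>gaussV I)"
    using comp by auto
  have sub: "{0} \<times> ({1..N} \<times> {1..N}) \<subseteq> I" by (auto simp: I_def B_def)
  show "integrable (disorder N) (\<lambda>J. ln (Zc N r J))"
    using iB ln_Zc_reindex(2)[OF sub] unfolding fB[abs_def] by blast
  have FB: "(\<integral>x. f B x \<partial>gaussV I) = free_energy N r"
    unfolding fB by (rule ln_Zc_reindex(1)[OF sub])
  define g where "g x = (\<Sum>i\<in>{1..N}. (a * x (1, i, 0) + \<beta> * h)\<^sup>2 / 2)" for x :: "nat \<times> nat \<times> nat \<Rightarrow> real"
  have fA: "f A x \<le> g x" for x
  proof -
    define v where "v z = one_body N z + (\<Sum>s\<in>A. x s * \<phi> s z) - (\<Sum>s\<in>A. (\<phi> s z)\<^sup>2) / 2" for z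
    have vm: "v \<in> borel_measurable (cubeM N r)"
      unfolding v_def using fin
      by (intro borel_measurable_add borel_measurable_diff borel_measurable_divide borel_measurable_sum
          borel_measurable_times borel_measurable_power borel_measurable_const \<phi>m one_body_measurable_cubeM) auto
    have vg: "v z \<le> g x" for z
      using linear_field_bound[OF a(1), of N z "\<lambda>i. x (1, i, 0)"]
      unfolding v_def g_def sumA by (simp add: \<phi>_def)
    have iv: "integrable (cubeM N r) (\<lambda>z. exp (v z))"
      using vm vg by (intro integrable_const_bound[of _ "exp (g x)"]) auto
    have "(\<integral>z. exp (v z) \<partial>cubeM N r) \<le> (\<integral>z. exp (g x) \<partial>cubeM N r)"
      using iv vg by (intro integral_mono) auto
    also have "\<dots> \<le> exp (g x) * 1"
      using measure_cubeM[of N r] prob_space.prob_le_1[OF prob_space_gaussN] by simp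
    finally have le: "(\<integral>z. exp (v z) \<partial>cubeM N r) \<le> exp (g x)" by simp
    \<comment> \<open>Since \<open>ln 0 = 0\<close> by convention, nonnegativity of
      \<open>g x\<close> settles the case of a vanishing integral.\<close>
    have "0 \<le> g x" unfolding g_def by (intro sum_nonneg) auto
    moreover have "0 \<le> (\<integral>z. exp (v z) \<partial>cubeM N r)" by simp
    ultimately have "ln (\<integral>z. exp (v z) \<partial>cubeM N r) \<le> g x"
    proof (cases "(\<integral>z. exp (v z) \<partial>cubeM N r) = 0")
      case False
      with \<open>0 \<le> (\<integral>z. exp (v z) \<partial>cubeM N r)\<close> have "0 < (\<integral>z. exp (v z) \<partial>cubeM N r)"
        by linarith
      then have "ln (\<integral>z. exp (v z) \<partial>cubeM N r) \<le> ln (exp (g x))"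
        using le by (subst ln_le_cancel_iff) auto
      then show ?thesis by simp
    qed simp
    then show ?thesis by (simp add: f_def v_def)
  qed
  have mom: "integrable (gaussV I) (\<lambda>x. x (1, i, 0))" "(\<integral>x. x (1, i, 0) \<partial>gaussV I) = 0"
    "integrable (gaussV I) (\<lambda>x. x (1, i, 0) * x (1, i, 0))" "(\<integral>x. x (1, i, 0) * x (1, i, 0) \<partial>gaussV I) = 1"
    if "i \<in> {1..N}" for i
    using gaussV_moments[OF fin(1), of "(1, i, 0)" "(1, i, 0)"] that by (auto simp: I_def A_def)
  note [simp] = finite_measure.integrable_const[OF prob_space.finite_measure[OF prob_space_gaussV]]
  have sq: "(a * x (1, i, 0) + \<beta> * h)\<^sup>2 / 2 = a\<^sup>2 / 2 * (x (1, i, 0) * x (1, i, 0)) + a * (\<beta> * h) * x (1, i, 0) + (\<beta> * h)\<^sup>2 / 2"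
    for x :: "nat \<times> nat \<times> nat \<Rightarrow> real" and i
    by (simp add: power2_eq_square field_simps)
  have gi: "integrable (gaussV I) (\<lambda>x. (a * x (1, i, 0) + \<beta> * h)\<^sup>2 / 2)"
    "(\<integral>x. (a * x (1, i, 0) + \<beta> * h)\<^sup>2 / 2 \<partial>gaussV I) = a\<^sup>2 / 2 + (\<beta> * h)\<^sup>2 / 2" if "i \<in> {1..N}" for i
    unfolding sq using mom[OF that] by simp_all
  have ig: "integrable (gaussV I) g"
    unfolding g_def using gi(1) by (rule Bochner_Integration.integrable_sum)
  have "(\<integral>x. g x \<partial>gaussV I) = (\<Sum>i\<in>{1..N}. \<integral>x. (a * x (1, i, 0) + \<beta> * h)\<^sup>2 / 2 \<partial>gaussV I)"
    unfolding g_def using gi(1) by (rule Bochner_Integration.integral_sum)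
  also have "\<dots> = (\<Sum>i\<in>{1..N}. a\<^sup>2 / 2 + (\<beta> * h)\<^sup>2 / 2)"
    using gi(2) by (rule sum.cong[OF refl])
  finally have "(\<integral>x. g x \<partial>gaussV I) = (\<Sum>i\<in>{1..N}. a\<^sup>2 / 2 + (\<beta> * h)\<^sup>2 / 2)" .
  then have "(\<integral>x. g x \<partial>gaussV I) = real N * ((\<bar>lam\<bar> + 1 + (\<beta> * h)\<^sup>2) / 2)"
    by (simp add: a add_divide_distrib)
  moreover have "(\<integral>x. f A x \<partial>gaussV I) \<le> (\<integral>x. g x \<partial>gaussV I)"
    using iA ig fA by (intro integral_mono) auto
  moreover have "real N * pressure_bound = real N * ((\<bar>lam\<bar> + 1 + (\<beta> * h)\<^sup>2) / 2) + D / 2"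
    by (simp add: pressure_bound_def D_def distrib_left)
  ultimately show "free_energy N r \<le> real N * pressure_bound"
    using le FB by linarith
qed

section \<open>Superadditivity and removal of the cutoff\<close>

text \<open>With the same cutoff for both blocks, their boxes form the box of the joint system. Two
  independent systems thus become one integral over joint configurations, as the comparison
  requires.\<close>

lemma Zc_mult:
  "Zc N1 r J1 * Zc N2 r J2 =
    (\<integral>z. exp (energy N1 J1 z + energy N2 J2 (\<lambda>i. z (N1 + i))) \<partial>cubeM (N1 + N2) r)"
proof -
  define g1 where "g1 z = indicator (cube N1 r) z * exp (energy N1 J1 z)" for z
  define g2 where "g2 z = indicator (cube N2 r) z * exp (energy N2 J2 z)" for z
  have m: "g1 \<in> borel_measurable (gaussN N1)" "g2 \<in> borel_measurable (gaussN N2)"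
    unfolding g1_def g2_def by measurable
  have "Zc N1 r J1 * Zc N2 r J2 =
    (\<integral>z. g1 (\<lambda>i\<in>{1..N1}. z i) * g2 (\<lambda>i\<in>{1..N2}. z (N1 + i)) \<partial>gaussN (N1 + N2))"
    unfolding Zc_def g1_def[symmetric] g2_def[symmetric]
    by (rule integral_gaussN_add[OF m, symmetric]) (simp_all add: g1_def g2_def)
  also have "\<dots> = (\<integral>z. indicator (cube (N1 + N2) r) z * exp (energy N1 J1 z + energy N2 J2 (\<lambda>i. z (N1 + i))) \<partial>gaussN (N1 + N2))"
  proof (rule Bochner_Integration.integral_cong[OF refl])
    fix z assume z: "z \<in> space (gaussN (N1 + N2))"
    have "(\<forall>i\<in>{1..N1 + N2}. \<bar>z i\<bar> \<le> r) \<longleftrightarrow> (\<forall>i\<in>{1..N1}. \<bar>z i\<bar> \<le> r) \<and> (\<forall>i\<in>{1..N2}. \<bar>z (N1 + i)\<bar> \<le> r)"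
    proof safe
      fix i assume *: "\<forall>i\<in>{1..N1}. \<bar>z i\<bar> \<le> r" "\<forall>i\<in>{1..N2}. \<bar>z (N1 + i)\<bar> \<le> r" "i \<in> {1..N1 + N2}"
      show "\<bar>z i\<bar> \<le> r"
      proof (cases "i \<le> N1")
        case True
        then show ?thesis using * by auto
      next
        case False
        then have "i - N1 \<in> {1..N2}" "N1 + (i - N1) = i" using *(3) by auto
        then show ?thesis using *(2) by metis
      qed
    qed auto
    then have ind: "indicator (cube (N1 + N2) r) z =
      (indicator (cube N1 r) (\<lambda>i\<in>{1..N1}. z i) * indicator (cube N2 r) (\<lambda>i\<in>{1..N2}. z (N1 + i)) :: real)"
      using z by (simp add: cube_def space_gaussN indicator_def)
    have "energy N2 J2 (\<lambda>i\<in>{1..N2}. z (N1 + i)) = energy N2 J2 (\<lambda>i. z (N1 + i))"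
      using energy_restrict(2)[of N2 J2 "\<lambda>i. z (N1 + i)"] .
    then show "g1 (\<lambda>i\<in>{1..N1}. z i) * g2 (\<lambda>i\<in>{1..N2}. z (N1 + i)) =
      indicator (cube (N1 + N2) r) z * exp (energy N1 J1 z + energy N2 J2 (\<lambda>i. z (N1 + i)))"
      unfolding g1_def g2_def ind energy_restrict(2) by (simp only: exp_add mult_ac)
  qed
  finally show ?thesis by (simp only: integral_cubeM)
qed

lemma one_body_add: "one_body (N1 + N2) z = one_body N1 z + one_body N2 (\<lambda>i. z (N1 + i))"
  by (simp only: one_body_def sum_shift_split distrib_left)

lemma free_energy_superadditive:
  assumes N1: "N1 \<ge> 1" and N2: "N2 \<ge> 1" and r: "r > 0"
  shows "free_energy N1 r + free_energy N2 r \<le> free_energy (N1 + N2) r"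
proof -
  define N where "N = N1 + N2"
  \<comment> \<open>Labels 0, 1, 2 mark the couplings of the full system and of the two blocks; the second block keeps local indices \<open>1..N2\<close>.\<close>
  define A where "A = {0::nat} \<times> ({1..N} \<times> {1..N})"
  define B1 where "B1 = {1::nat} \<times> ({1..N1} \<times> {1..N1})"
  define B2 where "B2 = {2::nat} \<times> ({1..N2} \<times> {1..N2})"
  define B where "B = B1 \<union> B2"
  define I where "I = A \<union> B"
  define \<phi> :: "nat \<times> nat \<times> nat \<Rightarrow> (nat \<Rightarrow> real) \<Rightarrow> real"
    where "\<phi> = (\<lambda>(k, i, j) z. if k = 0 then coupling N * z i * z j
      else if k = 1 then coupling N1 * z i * z j else coupling N2 * z (N1 + i) * z (N1 + j))"
  define b where "b = (coupling N + coupling N1 + coupling N2) * r\<^sup>2"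
  interpret finite_measure "cubeM N r" by (rule finite_measure_cubeM)
  have fin: "finite I" "A \<subseteq> I" "B \<subseteq> I" "A \<inter> B = {}" "finite B1" "finite B2" "B1 \<inter> B2 = {}"
    by (auto simp: I_def A_def B_def B1_def B2_def)
  have sumA: "(\<Sum>s\<in>A. g s) = (\<Sum>i\<in>{1..N}. \<Sum>j\<in>{1..N}. g (0, i, j))" for g :: "_ \<Rightarrow> real"
    unfolding A_def by (rule sum_block)
  have sumB: "(\<Sum>s\<in>B. g s) = (\<Sum>i\<in>{1..N1}. \<Sum>j\<in>{1..N1}. g (1, i, j)) + (\<Sum>i\<in>{1..N2}. \<Sum>j\<in>{1..N2}. g (2, i, j))"
    for g :: "_ \<Rightarrow> real"
    unfolding B_def sum.union_disjoint[OF fin(5-7)] unfolding B1_def B2_def by (simp only: sum_block)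
  \<comment> \<open>Every field component, of whichever system, is \<open>c * z i * z j\<close> in
    global indices; measurability and boundedness are read off from this form.\<close>
  have form: "\<exists>c i j. i \<in> {1..N} \<and> j \<in> {1..N} \<and> 0 \<le> c \<and> c * r\<^sup>2 \<le> b \<and> \<phi> s = (\<lambda>z. c * z i * z j)" if s: "s \<in> I" for s
  proof -
    have c: "0 \<le> coupling N * r\<^sup>2" "0 \<le> coupling N1 * r\<^sup>2" "0 \<le> coupling N2 * r\<^sup>2"
      using coupling_nonneg by (auto intro!: mult_nonneg_nonneg)
    consider i j where "s = (0, i, j)" "i \<in> {1..N}" "j \<in> {1..N}"
      | i j where "s = (1, i, j)" "i \<in> {1..N1}" "j \<in> {1..N1}"
      | i j where "s = (2, i, j)" "i \<in> {1..N2}" "j \<in> {1..N2}"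
      using s by (auto simp: I_def A_def B_def B1_def B2_def)
    then show ?thesis
    proof cases
      case 1
      then show ?thesis using c coupling_nonneg
        by (intro exI[of _ "coupling N"] exI[of _ i] exI[of _ j]) (auto simp: \<phi>_def b_def distrib_right)
    next
      case 2
      then show ?thesis using c coupling_nonneg
        by (intro exI[of _ "coupling N1"] exI[of _ i] exI[of _ j]) (auto simp: \<phi>_def b_def distrib_right N_def)
    next
      case 3
      then show ?thesis using c coupling_nonneg
        by (intro exI[of _ "coupling N2"] exI[of _ "N1 + i"] exI[of _ "N1 + j"]) (auto simp: \<phi>_def b_def distrib_right N_def)
    qed
  qed
  have \<phi>m: "\<phi> s \<in> borel_measurable (cubeM N r)" if s: "s \<in> I" for s
  proof (rule measurable_cubeM)
    obtain c i j where "i \<in> {1..N}" "j \<in> {1..N}" "\<phi> s = (\<lambda>z. c * z i * z j)"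
      using form[OF s] by blast
    then show "\<phi> s \<in> borel_measurable (gaussN N)" by simp
  qed
  have \<phi>b: "\<bar>\<phi> s z\<bar> \<le> b" if s: "s \<in> I" and z: "z \<in> space (cubeM N r)" for s z
  proof -
    obtain c i j where c: "i \<in> {1..N}" "j \<in> {1..N}" "0 \<le> c" "c * r\<^sup>2 \<le> b" "\<phi> s = (\<lambda>z. c * z i * z j)"
      using form[OF s] by blast
    have "\<bar>\<phi> s z\<bar> \<le> c * r\<^sup>2"
      using interaction_bound[of z N r i j c] z c by (simp add: space_cubeM)
    then show ?thesis using c(4) by simp
  qed
  have ker: "(\<Sum>s\<in>A. \<phi> s z * \<phi> s w) \<le> (\<Sum>s\<in>B. \<phi> s z * \<phi> s w) + 0" for z w
  proof -
    define p where "p = (\<Sum>i\<in>{1..N1}. z i * w i)"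
    define q where "q = (\<Sum>i\<in>{1..N2}. z (N1 + i) * w (N1 + i))"
    have "(\<Sum>s\<in>A. \<phi> s z * \<phi> s w) = \<beta>\<^sup>2 / (2 * real N) * (p + q)\<^sup>2"
      unfolding sumA p_def q_def sum_shift_split[of "\<lambda>i. z i * w i" N1 N2, folded N_def, symmetric]
      using sum_rank_one[of "coupling N" z w "{1..N}"] by (simp add: \<phi>_def coupling_sq)
    moreover have "(\<Sum>s\<in>B. \<phi> s z * \<phi> s w) = \<beta>\<^sup>2 / (2 * real N1) * p\<^sup>2 + \<beta>\<^sup>2 / (2 * real N2) * q\<^sup>2"
      unfolding sumB p_def q_def
      using sum_rank_one[of "coupling N1" z w "{1..N1}"]
        sum_rank_one[of "coupling N2" "\<lambda>i. z (N1 + i)" "\<lambda>i. w (N1 + i)" "{1..N2}"]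
      by (simp add: \<phi>_def coupling_sq)
    moreover have "\<beta>\<^sup>2 / (2 * real N) * (p + q)\<^sup>2 \<le> \<beta>\<^sup>2 / (2 * real N1) * p\<^sup>2 + \<beta>\<^sup>2 / (2 * real N2) * q\<^sup>2"
    proof -
      have pos: "real N1 > 0" "real N2 > 0" "real N > 0" "real N = real N1 + real N2"
        using N1 N2 by (auto simp: N_def)
      \<comment> \<open>Convexity made explicit: this nonnegative expression is exactly the
        covariance of the two blocks minus that of the full system.\<close>
      have "0 \<le> \<beta>\<^sup>2 / 2 * ((real N2 * p - real N1 * q)\<^sup>2 / (real N1 * real N2 * real N))" by simp
      also have "(real N2 * p - real N1 * q)\<^sup>2 / (real N1 * real N2 * real N) =
        p\<^sup>2 / real N1 + q\<^sup>2 / real N2 - (p + q)\<^sup>2 / real N"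
      proof -
        have "(y * p - x * q)\<^sup>2 / (x * y * (x + y)) = p\<^sup>2 / x + q\<^sup>2 / y - (p + q)\<^sup>2 / (x + y)"
          if "x > 0" "y > 0" for x y :: real
        proof -
          have "x + y \<noteq> 0" using that by simp
          then show ?thesis using that
            by (simp add: divide_simps) (simp add: power2_eq_square algebra_simps)
        qed
        from this[OF pos(1,2)] show ?thesis by (simp only: pos(4))
      qed
      finally show ?thesis by (simp add: algebra_simps)
    qed
    ultimately show ?thesis by simp
  qed
  have pos: "0 < measure (cubeM N r) (space (cubeM N r))"
    unfolding measure_cubeM by (rule cube_pos[OF r])
  define f where "f S x = ln (\<integral>z. exp (one_body N z + (\<Sum>s\<in>S. x s * \<phi> s z) - (\<Sum>s\<in>S. (\<phi> s z)\<^sup>2) / 2) \<partial>cubeM N r)" for S x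
  note comp = gaussian_comparison[where I = I and A = A and B = B and \<phi> = \<phi> and D = 0, OF fin(1-4) \<phi>m \<phi>b
    one_body_measurable_cubeM one_body_bound pos ker, unfolded space_cubeM, folded f_def]
  have fA: "f A x = ln (Zc N r (\<lambda>p. x (0, p)))" for x
    unfolding f_def Zc_cubeM sumA energy_eq by (simp add: \<phi>_def)
  have fB: "f B x = ln (Zc N1 r (\<lambda>p. x (1, p))) + ln (Zc N2 r (\<lambda>p. x (2, p)))" for x
  proof -
    have "one_body N z + (\<Sum>s\<in>B. x s * \<phi> s z) - (\<Sum>s\<in>B. (\<phi> s z)\<^sup>2) / 2 =
      energy N1 (\<lambda>p. x (1, p)) z + energy N2 (\<lambda>p. x (2, p)) (\<lambda>i. z (N1 + i))" for z
      unfolding sumB energy_eq N_def one_body_add by (simp add: \<phi>_def add_divide_distrib)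
    then have "f B x = ln (Zc N1 r (\<lambda>p. x (1, p)) * Zc N2 r (\<lambda>p. x (2, p)))"
      unfolding f_def Zc_mult by (simp add: N_def)
    then show ?thesis
      using Zc_pos(1)[OF r] by (simp add: ln_mult less_imp_neq[symmetric])
  qed
  have sub: "{0} \<times> ({1..N} \<times> {1..N}) \<subseteq> I" "{1} \<times> ({1..N1} \<times> {1..N1}) \<subseteq> I" "{2} \<times> ({1..N2} \<times> {1..N2}) \<subseteq> I"
    by (auto simp: I_def A_def B_def B1_def B2_def)
  have "(\<integral>x. f B x \<partial>gaussV I) = free_energy N1 r + free_energy N2 r"
    unfolding fB ln_Zc_reindex(1)[OF sub(2), symmetric] ln_Zc_reindex(1)[OF sub(3), symmetric]
    using ln_Zc_reindex(2)[OF sub(2)] ln_Zc_reindex(2)[OF sub(3)]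
      free_energy_upper(2)[OF N1 r] free_energy_upper(2)[OF N2 r]
    by (intro Bochner_Integration.integral_add) blast+
  moreover have "(\<integral>x. f A x \<partial>gaussV I) = free_energy N r"
    unfolding fA by (rule ln_Zc_reindex(1)[OF sub(1)])
  moreover have "(\<integral>x. f B x \<partial>gaussV I) - 0 / 2 \<le> (\<integral>x. f A x \<partial>gaussV I)"
    using comp by auto
  ultimately show ?thesis by (simp add: N_def)
qed

text \<open>At fixed \<open>J\<close> all other terms grow at most linearly in the squared norm
  \<open>R\<close> of \<open>z\<close>, while the quartic term is \<open>- k * R^2\<close> with
  \<open>k > 0\<close>. Hence the Boltzmann weight is integrable for every \<open>lam\<close>, with
  a constant as dominating function when the cube grows.\<close>

lemma energy_bounded_above:
  assumes N: "N \<ge> 1"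
  obtains C where "\<And>z. energy N J z \<le> C"
proof -
  define S where "S = (\<Sum>i\<in>{1..N}. \<Sum>j\<in>{1..N}. \<bar>J (i, j)\<bar>)"
  define k where "k = \<beta>\<^sup>2 / (4 * real N)"
  define K where "K = coupling N * S + \<bar>\<beta> * h\<bar> + \<bar>lam\<bar> / 2"
  have k: "k > 0" using N \<beta> by (simp add: k_def)
  have "energy N J z \<le> K\<^sup>2 / (4 * k) + \<bar>\<beta> * h\<bar> * real N" for z
  proof -
    define R where "R = (\<Sum>i\<in>{1..N}. (z i)\<^sup>2)"
    have R0: "R \<ge> 0" by (simp add: R_def sum_nonneg)
    have zR: "(z i)\<^sup>2 \<le> R" if "i \<in> {1..N}" for i
      unfolding R_def using that by (intro member_le_sum) auto
    have zz: "\<bar>z i * z j\<bar> \<le> R" if "i \<in> {1..N}" "j \<in> {1..N}" for i j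
    proof -
      have "0 \<le> (\<bar>z i\<bar> - \<bar>z j\<bar>)\<^sup>2" by simp
      then have "2 * \<bar>z i * z j\<bar> \<le> (z i)\<^sup>2 + (z j)\<^sup>2"
        by (simp add: power2_diff abs_mult)
      then show ?thesis using zR[OF that(1)] zR[OF that(2)] by linarith
    qed
    have "J (i, j) * z i * z j \<le> \<bar>J (i, j)\<bar> * R" if "i \<in> {1..N}" "j \<in> {1..N}" for i j
      using mult_left_mono[OF zz[OF that], of "\<bar>J (i, j)\<bar>"] abs_ge_self[of "J (i, j) * (z i * z j)"]
      by (simp add: abs_mult mult.assoc)
    then have "(\<Sum>i\<in>{1..N}. \<Sum>j\<in>{1..N}. J (i, j) * z i * z j) \<le> S * R"
      unfolding S_def sum_distrib_right by (intro sum_mono) auto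
    then have 1: "coupling N * (\<Sum>i\<in>{1..N}. \<Sum>j\<in>{1..N}. J (i, j) * z i * z j) \<le> coupling N * (S * R)"
      using coupling_nonneg by (intro mult_left_mono) auto
    have "\<bar>\<Sum>i\<in>{1..N}. z i\<bar> \<le> (\<Sum>i\<in>{1..N}. 1 + (z i)\<^sup>2)"
    proof (intro order_trans[OF sum_abs] sum_mono)
      fix i
      have "0 \<le> (\<bar>z i\<bar> - 1)\<^sup>2" by simp
      then have "2 * \<bar>z i\<bar> \<le> 1 + (z i)\<^sup>2" by (simp add: power2_diff)
      then show "\<bar>z i\<bar> \<le> 1 + (z i)\<^sup>2" by linarith
    qed
    then have "\<bar>\<Sum>i\<in>{1..N}. z i\<bar> \<le> real N + R"
      by (simp add: sum.distrib R_def)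
    then have "\<bar>\<beta> * h\<bar> * \<bar>\<Sum>i\<in>{1..N}. z i\<bar> \<le> \<bar>\<beta> * h\<bar> * (real N + R)"
      by (intro mult_left_mono) auto
    then have 2: "\<beta> * h * (\<Sum>i\<in>{1..N}. z i) \<le> \<bar>\<beta> * h\<bar> * (real N + R)"
      using abs_ge_self[of "\<beta> * h * (\<Sum>i\<in>{1..N}. z i)"] by (simp only: abs_mult)
    have 3: "lam / 2 * R \<le> \<bar>lam\<bar> / 2 * R"
      using R0 by (intro mult_right_mono) auto
    have "energy N J z \<le> K * R - k * R\<^sup>2 + \<bar>\<beta> * h\<bar> * real N"
      unfolding energy_def K_def coupling_def[symmetric] R_def[symmetric] k_def[symmetric]
      using 1 2 3 by (simp add: algebra_simps)
    moreover have "K * R - k * R\<^sup>2 \<le> K\<^sup>2 / (4 * k)"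
    proof -
      have "0 \<le> (K - 2 * k * R)\<^sup>2 / (4 * k)" using k by simp
      also have "\<dots> = K\<^sup>2 / (4 * k) - (K * R - k * R\<^sup>2)"
        using k by (simp add: field_simps power2_eq_square)
      finally show ?thesis by simp
    qed
    ultimately show ?thesis by linarith
  qed
  then show ?thesis by (rule that)
qed

lemma Zc_tendsto:
  assumes N: "N \<ge> 1"
  shows "(\<lambda>n. Zc N (real (Suc n)) J) \<longlonglongrightarrow> partition_fn N \<beta> lam h J"
    and "Zc N r J \<le> partition_fn N \<beta> lam h J" and "r \<le> s \<Longrightarrow> Zc N r J \<le> Zc N s J"
proof -
  interpret G: prob_space "gaussN N" by (rule prob_space_gaussN)
  obtain C where C: "\<And>z. energy N J z \<le> C" using energy_bounded_above[OF N, of J] by blast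
  have pf: "partition_fn N \<beta> lam h J = (\<integral>z. exp (energy N J z) \<partial>gaussN N)"
    by (simp only: partition_fn_def energy_def)
  have ie: "integrable (gaussN N) (\<lambda>z. exp (energy N J z))"
    using C by (intro G.integrable_const_bound[of _ "exp C"]) auto
  have ic: "integrable (gaussN N) (\<lambda>z. indicator (cube N r) z * exp (energy N J z))" for r
    using C by (intro G.integrable_const_bound[of _ "exp C"]) (auto simp: indicator_def)
  show "(\<lambda>n. Zc N (real (Suc n)) J) \<longlonglongrightarrow> partition_fn N \<beta> lam h J"
    unfolding pf Zc_def
  proof (rule integral_dominated_convergence[where w = "\<lambda>_. exp C"])
    show "AE z in gaussN N. (\<lambda>n. indicator (cube N (real (Suc n))) z * exp (energy N J z)) \<longlonglongrightarrow> exp (energy N J z)"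
    proof (rule AE_I2)
      fix z assume z: "z \<in> space (gaussN N)"
      \<comment> \<open>The sum bounds all coordinates at once, so \<open>z\<close> lies in every
        sufficiently large cube.\<close>
      obtain m where m: "(\<Sum>i\<in>{1..N}. \<bar>z i\<bar>) \<le> real m" using real_arch_simple by blast
      have "z \<in> cube N (real (Suc n))" if "n \<ge> m" for n
      proof -
        have "\<bar>z i\<bar> \<le> (\<Sum>i\<in>{1..N}. \<bar>z i\<bar>)" if "i \<in> {1..N}" for i
          using that by (intro member_le_sum) auto
        then show ?thesis using m that z unfolding cube_def by fastforce
      qed
      then have "eventually (\<lambda>n. indicator (cube N (real (Suc n))) z * exp (energy N J z) = exp (energy N J z)) sequentially"
        by (intro eventually_sequentiallyI[of m]) simp
      then show "(\<lambda>n. indicator (cube N (real (Suc n))) z * exp (energy N J z)) \<longlonglongrightarrow> exp (energy N J z)"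
        by (rule tendsto_eventually)
    qed
  qed (use C in \<open>auto simp: indicator_def\<close>)
  show "Zc N r J \<le> partition_fn N \<beta> lam h J"
    unfolding pf Zc_def using ie ic by (intro integral_mono) (auto simp: indicator_def)
  show "Zc N r J \<le> Zc N s J" if "r \<le> s"
  proof -
    have "cube N r \<subseteq> cube N s" using that by (auto simp: cube_def)
    then show ?thesis
      unfolding Zc_def using ic by (intro integral_mono) (auto simp: indicator_def)
  qed
qed

text \<open>The logarithms increase with the cube, and their means stay below
  \<open>real N * pressure_bound\<close>. Monotone convergence therefore identifies the mean of the
  limiting logarithm, and no tail estimate on the disorder is called for. The radius
  \<open>Suc n\<close> keeps the cutoff positive.\<close>

lemma free_energy_tendsto:
  assumes N: "N \<ge> 1"
  shows "(\<lambda>n. free_energy N (real (Suc n))) \<longlonglongrightarrow> real N * pressure N \<beta> lam h"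
proof -
  define f where "f n J = ln (Zc N (real (Suc n)) J)" for n J
  have int: "integrable (disorder N) (f n)" for n
    unfolding f_def using free_energy_upper(2)[OF N] by simp
  have mono: "mono (\<lambda>n. f n J)" for J
  proof (rule monoI)
    fix m n :: nat assume "m \<le> n"
    then show "f m J \<le> f n J"
      unfolding f_def using Zc_pos(1) Zc_tendsto(3)[OF N] by (subst ln_le_cancel_iff) auto
  qed
  have pos: "0 < partition_fn N \<beta> lam h J" for J
    using Zc_pos(1)[of 1 N J] Zc_tendsto(2)[OF N, of 1 J] by linarith
  have lim: "(\<lambda>n. f n J) \<longlonglongrightarrow> ln (partition_fn N \<beta> lam h J)" for J
    unfolding f_def using pos[of J] by (intro tendsto_ln Zc_tendsto(1)[OF N]) auto
  have fe: "free_energy N (real (Suc n)) = (\<integral>J. f n J \<partial>disorder N)" for n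
    by (simp add: free_energy_def f_def)
  have "incseq (\<lambda>n. free_energy N (real (Suc n)))"
    unfolding fe by (intro incseq_SucI integral_mono int monoD[OF mono]) simp
  then obtain L where L: "(\<lambda>n. free_energy N (real (Suc n))) \<longlonglongrightarrow> L"
    using free_energy_upper(1)[OF N] by (elim incseq_convergent[of _ "real N * pressure_bound"]) auto
  have "(\<integral>J. ln (partition_fn N \<beta> lam h J) \<partial>disorder N) = L"
  proof (rule integral_monotone_convergence[where f = f])
    show "(\<lambda>J. ln (partition_fn N \<beta> lam h J)) \<in> borel_measurable (disorder N)"
      by (rule borel_measurable_LIMSEQ_real[where u = f, OF lim]) (use int in auto)
  qed (use int mono lim L fe in auto)
  then show ?thesis
    using L N by (simp add: pressure_def)
qed

lemma pressure_upper:
  assumes "N \<ge> 1"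
  shows "pressure N \<beta> lam h \<le> pressure_bound"
proof -
  have "real N * pressure N \<beta> lam h \<le> real N * pressure_bound"
    by (rule LIMSEQ_le_const2[OF free_energy_tendsto[OF assms]])
       (use free_energy_upper(1)[OF assms] in auto)
  then show ?thesis using assms by simp
qed

lemma pressure_superadditive:
  "real m * pressure m \<beta> lam h + real n * pressure n \<beta> lam h \<le> real (m + n) * pressure (m + n) \<beta> lam h"
\<comment> \<open>A block of size 0 contributes 0 through the factor \<open>real 0\<close>;
  superadditivity is stated for all \<open>m\<close> and \<open>n\<close> to match Fekete's
  lemma.\<close>
proof (cases "m = 0 \<or> n = 0")
  case False
  then have mn: "m \<ge> 1" "n \<ge> 1" by auto
  show ?thesis
    by (rule LIMSEQ_le[OF tendsto_add[OF free_energy_tendsto[OF mn(1)] free_energy_tendsto[OF mn(2)]]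
        free_energy_tendsto]) (use mn free_energy_superadditive[OF mn] in auto)
qed auto

end

theorem mainTheorem3:
  fixes \<beta> lam h :: real
  assumes "\<beta> > 0"
  shows "(\<lambda>N. pressure N \<beta> lam h) \<longlonglongrightarrow> (SUP N\<in>{1..}. pressure N \<beta> lam h)"
proof -
  interpret spin_glass \<beta> lam h by unfold_locales (rule assms)
  \<comment> \<open>At \<open>N = 0\<close> both sides are 0, because division by zero yields
    0.\<close>
  have eq: "real N * pressure N \<beta> lam h / real N = pressure N \<beta> lam h" for N
    by (cases "N = 0") (simp_all add: pressure_def)
  have "(\<lambda>N. real N * pressure N \<beta> lam h / real N) \<longlonglongrightarrow> (SUP N\<in>{1..}. real N * pressure N \<beta> lam h / real N)"
    by (rule fekete_superadditive[OF pressure_superadditive, where C = pressure_bound])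
       (simp only: eq pressure_upper)
  then show ?thesis by (simp only: eq)
qed

end
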